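(* Let $k\ge 1$, $r\ge 2$, $n\ge 1$ be integers such that $k+1$ and $r-1$ are relatively prime, and let $t,q\in\mathbb{C}$ be primitive roots of unity of orders $k+1$ and $r-1$, respectively. For every $(r-1)$-slim partition $\mu\in\pi_n$ let $g_\mu\in\mathbb{C}[x_1,\dots,x_n]^{\mathfrak{S}_n}$ be any symmetric polynomial of highest partition $\mu$. Let $\{\tilde f_\lambda\}$, indexed by the admissible partitions $\lambda\in\pi_n$, be any basis of the vector space $F_n^{(k,2)}$, and put $f_\lambda(x_1,\dots,x_n)=\tilde f_\lambda(x_1^{r-1},\dots,x_n^{r-1})$. Then the polynomials $\{f_\lambda g_\mu\}$, where $\mu$ ranges over all $(r-1)$-slim partitions in $\pi_n$ and $\lambda$ ranges over all admissible partitions in $\pi_n$, form a basis of the complex vector space $F_n^{(k,r)}$.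
   Context: $\pi_n$ is the set of sequences of integers $\lambda=(\lambda_1,\dots,\lambda_n)$ with $\lambda_1\ge\dots\ge\lambda_n\ge 0$; $|\lambda|=\sum_i\lambda_i$ is the weight; $m_i(\lambda)$ ($i\ge 0$) is the number of indices $j\in\{1,\dots,n\}$ with $\lambda_j=i$. A partition $\lambda\in\pi_n$ is called admissible (for the given $k$) if $m_i(\lambda)\le k$ for all $i\ge 0$. A partition $\lambda\in\pi_n$ is called $(r-1)$-slim if $\lambda_i-\lambda_{i+1}<r-1$ for $i=1,\dots,n-1$ and $\lambda_n<r-1$. Dominance order: for $\lambda,\mu\in\pi_n$ of the same weight, $\lambda>\mu$ means $\lambda\ne\mu$ and $\lambda_1+\dots+\lambda_i\ge\mu_1+\dots+\mu_i$ for all $i$. $m_\lambda$ is the monomial symmetric polynomial in $x_1,\dots,x_n$, i.e. the sum of all distinct monomials obtained from $x_1^{\lambda_1}\cdots x_n^{\lambda_n}$ by permuting the variables. A symmetric polynomial $f$ is of highest partition $\lambda$ if $f=c_\lambda m_\lambda+\sum_{\mu<\lambda}c_\mu m_\mu$ with $c_\mu\in\mathbb{C}$ and $c_\lambda\neq 0$. $F_n^{(k,r)}$ is the space of all symmetric polynomials $f\in\mathbb{C}[x_1,\dots,x_n]^{\mathfrak{S}_n}$ that vanish whenever $x_i=t^{i-1}q^{s_i}x_1$ for $1<i\le k+1$, for every choice of $s_2,\dots,s_{k+1}\in\{0,1,\dots,r-2\}$ (no condition if $n\le k$). For $r=2$ (so that $q$ is replaced by $1$), $F_n^{(k,2)}$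 is the space of symmetric polynomials $f$ with $f(x,tx,t^2x,\dots,t^kx,x_{k+2},\dots,x_n)=0$ identically (no condition if $n\le k$). *)

theory Defs
  imports Complex_Main "HOL-Library.Poly_Mapping" "HOL-Combinatorics.Permutations"
begin

(* A polynomial maps exponent vectors to coefficients, with multiplication from Poly_Mapping.
   Variables are numbered from 0: x_1, ..., x_n are variables 0, ..., n - 1. *)
type_synonym cpoly = "(nat \<Rightarrow>\<^sub>0 nat) \<Rightarrow>\<^sub>0 complex"

definition Const :: "complex \<Rightarrow> cpoly" where
  "Const c = Poly_Mapping.single 0 c"

definition Var :: "nat \<Rightarrow> cpoly" where
  "Var i = Poly_Mapping.single (Poly_Mapping.single i 1) 1"

definition scale :: "complex \<Rightarrow> cpoly \<Rightarrow> cpoly" where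
  "scale c f = Const c * f"

global_interpretation cpoly: vector_space scale
proof
  fix a b :: complex and x y :: cpoly
  show "scale a (x + y) = scale a x + scale a y"
    by (simp add: scale_def distrib_left)
  show "scale (a + b) x = scale a x + scale b x"
    by (simp add: scale_def Const_def single_add distrib_right)
  show "scale a (scale b x) = scale (a * b) x"
    by (simp add: scale_def Const_def mult.assoc[symmetric] mult_single)
  show "scale 1 x = x"
    by (simp add: scale_def Const_def)
qed

(* Substitution of x i for variable i, with coefficients embedded by h: evaluation at a point
   for h = id, substitution of polynomials for h = Const. *)
definition insertion :: "(complex \<Rightarrow> 'a::comm_semiring_1) \<Rightarrow> (nat \<Rightarrow> 'a) \<Rightarrow> cpoly \<Rightarrow> 'a" where
  "insertion h x f =
     (\<Sum>m\<in>Poly_Mapping.keys f. h (Poly_Mapping.lookup f m) *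
        (\<Prod>i\<in>Poly_Mapping.keys m. x i ^ Poly_Mapping.lookup m i))"

definition eval_at :: "(nat \<Rightarrow> complex) \<Rightarrow> cpoly \<Rightarrow> complex" where
  "eval_at x f = insertion id x f"

definition substitute :: "(nat \<Rightarrow> cpoly) \<Rightarrow> cpoly \<Rightarrow> cpoly" where
  "substitute p f = insertion Const p f"

definition polys :: "nat \<Rightarrow> cpoly set" where
  "polys n = {f. \<forall>m\<in>Poly_Mapping.keys f. Poly_Mapping.keys m \<subseteq> {..<n}}"

definition permute_vars :: "(nat \<Rightarrow> nat) \<Rightarrow> cpoly \<Rightarrow> cpoly" where
  "permute_vars \<sigma> f = substitute (\<lambda>i. Var (\<sigma> i)) f"

definition sym_polys :: "nat \<Rightarrow> cpoly set" where
  "sym_polys n = {f \<in> polys n. \<forall>\<sigma>. \<sigma> permutes {..<n} \<longrightarrow> permute_vars \<sigma> f = f}"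

definition partitions :: "nat \<Rightarrow> nat list set" where
  "partitions n = {l. length l = n \<and> sorted_wrt (\<ge>) l}"

definition admissible_partitions :: "nat \<Rightarrow> nat \<Rightarrow> nat list set" where
  "admissible_partitions n k = {l \<in> partitions n. \<forall>i. count_list l i \<le> k}"

definition slim_partitions :: "nat \<Rightarrow> nat \<Rightarrow> nat list set" where
  "slim_partitions n d =
     {l \<in> partitions n. (\<forall>i. Suc i < n \<longrightarrow> l ! i - l ! Suc i < d) \<and> l ! (n - 1) < d}"

definition dominated :: "nat \<Rightarrow> nat list \<Rightarrow> nat list set" where
  "dominated n l =
     {l' \<in> partitions n. sum_list l' = sum_list l \<and> l' \<noteq> l \<and>
        (\<forall>i\<le>n. sum_list (take i l') \<le> sum_list (take i l))}"

lemma finite_dominated: "finite (dominated n l)"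
proof (rule finite_subset)
  show "dominated n l \<subseteq> {xs. set xs \<subseteq> {..sum_list l} \<and> length xs = n}"
    by (auto simp: dominated_def partitions_def dest: member_le_sum_list)
  show "finite {xs. set xs \<subseteq> {..sum_list l} \<and> length xs = n}"
    by (rule finite_lists_length_eq) simp
qed

(* The sum runs over the set of permuted monomials, so each distinct one counts once. *)
definition monomial_sym :: "nat \<Rightarrow> nat list \<Rightarrow> cpoly" where
  "monomial_sym n l =
     \<Sum>{permute_vars \<sigma> (\<Prod>i<n. Var i ^ (l ! i)) | \<sigma>. \<sigma> permutes {..<n}}"

definition has_highest_partition :: "nat \<Rightarrow> cpoly \<Rightarrow> nat list \<Rightarrow> bool" where
  "has_highest_partition n f l \<longleftrightarrow>
     (\<exists>c. c l \<noteq> 0 \<and>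
        f = scale (c l) (monomial_sym n l)
            + (\<Sum>l'\<in>dominated n l. scale (c l') (monomial_sym n l')))"

definition primitive_root_of_unity :: "nat \<Rightarrow> complex \<Rightarrow> bool" where
  "primitive_root_of_unity m z \<longleftrightarrow>
     m > 0 \<and> z ^ m = 1 \<and> (\<forall>j. 0 < j \<and> j < m \<longrightarrow> z ^ j \<noteq> 1)"

(* Points of C^n are functions on nat, of which a polynomial in polys n only sees the values
   below n. With variables numbered from 0, the condition on x_2, ..., x_{k+1} concerns
   the indices 1, ..., k. *)
definition F_space :: "nat \<Rightarrow> nat \<Rightarrow> nat \<Rightarrow> complex \<Rightarrow> complex \<Rightarrow> cpoly set" where
  "F_space n k r t q =
     {f \<in> sym_polys n. k < n \<longrightarrow>
        (\<forall>s x. (\<forall>i\<in>{1..k}. s i \<in> {0..r - 2}) \<longrightarrow>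
               (\<forall>i\<in>{1..k}. x i = t ^ i * q ^ s i * x 0) \<longrightarrow> eval_at x f = 0)}"

abbreviation F2_space :: "nat \<Rightarrow> nat \<Rightarrow> complex \<Rightarrow> cpoly set" where
  "F2_space n k t \<equiv> F_space n k 2 t 1"

lemma mem_F2_space_iff:
  "f \<in> F2_space n k t \<longleftrightarrow>
     f \<in> sym_polys n \<and>
     (k < n \<longrightarrow> (\<forall>x. (\<forall>i\<in>{1..k}. x i = t ^ i * x 0) \<longrightarrow> eval_at x f = 0))"
  by (auto simp: F_space_def)

definition is_basis :: "cpoly set \<Rightarrow> 'i set \<Rightarrow> ('i \<Rightarrow> cpoly) \<Rightarrow> bool" where
  "is_basis V I b \<longleftrightarrow>
     inj_on b I \<and> cpoly.independent (b ` I) \<and> cpoly.span (b ` I) = V"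

end

(* Write d = r - 1. Every symmetric polynomial is a combination of the g_mu with coefficients
   h_mu(x_1^d, ..., x_n^d), h_mu symmetric: each partition is d * nu + mu with mu slim, and the
   product of the dilated m_nu with g_mu has leading exponent d * nu + mu.
   Let f = sum of h_mu(x^d) g_mu satisfy the vanishing condition, and let x satisfy
   x_i = t^(i-1) x_1 with the x_i^d distinct and nonzero. The d^n points obtained from x by
   multiplying coordinates by powers of q again satisfy the condition, so f vanishes at them, while
   the h_mu(x^d) do not change. As the points lie in distinct orbits, symmetric polynomials
   separate them; hence so do the g_mu, which number at most d^n and are therefore linearly
   independent on these points. So all h_mu(x^d) are 0, and by continuity h_mu satisfies the
   condition for r = 2 and the root t^d, which is primitive of order k + 1 since d and k + 1 are
   coprime; for symmetric polynomials the conditions for t and t^d agree. *)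
theory Submission
  imports Defs "HOL-Computational_Algebra.Polynomial" "HOL-Library.Function_Algebras"
    "HOL-Number_Theory.Cong"
begin

text \<open>Since \<open>g\<close> is arbitrary apart from its highest partitions, no explicit
  determinant can show independence; counting replaces it. On a fibre of the d-th power map over a
  point with distinct nonzero coordinates, the factors h_mu(x^d) are constants. Generation and
  separation therefore make the restrictions of the \<open>g \<mu>\<close> span all functions on d^n
  points, and a spanning family of at most d^n members is independent. The same argument without any
  vanishing condition shows that a combination equal to 0 has all h_mu = 0, which gives the
  independence of the products.

  Dominance is only a partial order, so leading terms are measured by one number, \<open>wt\<close>.
  It is additive in the exponent, scales under dilation and is strictly monotone in dominance on
  partitions, so generation becomes an induction over the natural numbers.

  The passage to the limit must not leave the linear condition on the first k + 1 coordinates. A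
  special point is therefore approached along a line whose direction is a fixed generic point
  satisfying that same condition.\<close>

abbreviation lookup :: "('a \<Rightarrow>\<^sub>0 'b) \<Rightarrow> 'a \<Rightarrow> 'b::zero" where
  "lookup \<equiv> Poly_Mapping.lookup"

abbreviation keys :: "('a \<Rightarrow>\<^sub>0 'b::zero) \<Rightarrow> 'a set" where
  "keys \<equiv> Poly_Mapping.keys"

abbreviation single :: "'a \<Rightarrow> 'b \<Rightarrow> 'a \<Rightarrow>\<^sub>0 'b::zero" where
  "single \<equiv> Poly_Mapping.single"

section \<open>Substitution homomorphisms\<close>

definition mon_val :: "(nat \<Rightarrow> 'a::comm_semiring_1) \<Rightarrow> (nat \<Rightarrow>\<^sub>0 nat) \<Rightarrow> 'a" where
  "mon_val x m = (\<Prod>i\<in>keys m. x i ^ lookup m i)"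

lemma mon_val_superset:
  assumes "finite A" "keys m \<subseteq> A"
  shows "mon_val x m = (\<Prod>i\<in>A. x i ^ lookup m i)"
  unfolding mon_val_def using assms
  by (intro prod.mono_neutral_left) (auto simp: in_keys_iff)

lemma mon_val_0 [simp]: "mon_val x 0 = 1"
  by (simp add: mon_val_def)

lemma mon_val_add: "mon_val x (a + b) = mon_val x a * mon_val x b"
proof -
  let ?A = "keys a \<union> keys b"
  have "mon_val x c = (\<Prod>i\<in>?A. x i ^ lookup c i)" if "keys c \<subseteq> ?A" for c
    using that by (intro mon_val_superset) auto
  then show ?thesis
    using keys_add[of a b] by (simp add: lookup_add power_add prod.distrib)
qed

lemma poly_mapping_eq_sum_single: "f = (\<Sum>m\<in>keys f. single m (lookup f m))"
proof (rule poly_mapping_eqI)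
  fix m
  show "lookup f m = lookup (\<Sum>m\<in>keys f. single m (lookup f m)) m"
    by (cases "m \<in> keys f")
       (auto simp: lookup_sum lookup_single when_def sum.delta' in_keys_iff)
qed

text \<open>Gives the homomorphism laws of \<open>insertion\<close> once, for complex values and for
  values in \<open>cpoly\<close>.\<close>

locale coeff_hom =
  fixes h :: "complex \<Rightarrow> 'a::comm_semiring_1"
  assumes h_0: "h 0 = 0" and h_1: "h 1 = 1"
    and h_add: "h (a + b) = h a + h b" and h_mult: "h (a * b) = h a * h b"
begin

lemma insertion_superset:
  assumes "finite A" "keys f \<subseteq> A"
  shows "insertion h x f = (\<Sum>m\<in>A. h (lookup f m) * mon_val x m)"
  unfolding insertion_def mon_val_def using assms
  by (intro sum.mono_neutral_left) (auto simp: in_keys_iff h_0)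

lemma insertion_0 [simp]: "insertion h x 0 = 0"
  by (simp add: insertion_def)

lemma insertion_single: "insertion h x (single m c) = h c * mon_val x m"
  by (subst insertion_superset[of "{m}"]) auto

lemma insertion_1 [simp]: "insertion h x 1 = 1"
  using insertion_single[of x 0 1] by (simp add: h_1)

lemma insertion_add: "insertion h x (f + g) = insertion h x f + insertion h x g"
proof -
  let ?A = "keys f \<union> keys g"
  have "insertion h x u = (\<Sum>m\<in>?A. h (lookup u m) * mon_val x m)" if "keys u \<subseteq> ?A" for u
    using that by (intro insertion_superset) auto
  then show ?thesis
    using keys_add[of f g] by (simp add: lookup_add h_add distrib_right sum.distrib)
qed

lemma insertion_sum: "insertion h x (sum f A) = (\<Sum>a\<in>A. insertion h x (f a))"
  by (induction A rule: infinite_finite_induct) (auto simp: insertion_add)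

lemma insertion_mult: "insertion h x (f * g) = insertion h x f * insertion h x g"
proof -
  have *: "insertion h x u = (\<Sum>m\<in>keys u. h (lookup u m) * mon_val x m)" for u
    by (rule insertion_superset) auto
  have "insertion h x (f * g) =
      insertion h x ((\<Sum>m\<in>keys f. single m (lookup f m)) * (\<Sum>m\<in>keys g. single m (lookup g m)))"
    using poly_mapping_eq_sum_single[of f] poly_mapping_eq_sum_single[of g] by simp
  also have "\<dots> = insertion h x f * insertion h x g"
    by (simp add: sum_product mult_single insertion_sum insertion_single h_mult mon_val_add
        *[of f] *[of g] ac_simps)
  finally show ?thesis .
qed

lemma insertion_prod: "insertion h x (prod f A) = (\<Prod>a\<in>A. insertion h x (f a))"
  by (induction A rule: infinite_finite_induct) (auto simp: insertion_mult)

lemma insertion_power: "insertion h x (f ^ k) = insertion h x f ^ k"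
  by (induction k) (auto simp: insertion_mult)

lemma insertion_Const [simp]: "insertion h x (Const c) = h c"
  by (simp add: Const_def insertion_single)

lemma insertion_Var [simp]: "insertion h x (Var i) = x i"
  by (simp add: Var_def insertion_single h_1 mon_val_def)

lemma insertion_scale: "insertion h x (scale c f) = h c * insertion h x f"
  by (simp add: scale_def insertion_mult)

lemma insertion_substitute:
  "insertion h x (substitute p f) = insertion h (\<lambda>i. insertion h x (p i)) f"
  unfolding substitute_def insertion_def[of Const]
  by (simp add: insertion_sum insertion_mult insertion_prod insertion_power)
     (simp add: insertion_def)

end

global_interpretation eval: coeff_hom id
  by standard auto

global_interpretation subst: coeff_hom Const
  by standard (auto simp: Const_def single_add mult_single)

lemmas eval_at_simps = eval.insertion_add eval.insertion_sum eval.insertion_mult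
  eval.insertion_prod eval.insertion_scale eval.insertion_power eval.insertion_0
  eval.insertion_1 eval.insertion_Const eval.insertion_Var id_apply
lemmas eval_at_hom = eval_at_simps[folded eval_at_def]

lemmas substitute_simps = subst.insertion_add subst.insertion_sum subst.insertion_mult
  subst.insertion_prod subst.insertion_power subst.insertion_0
  subst.insertion_1 subst.insertion_Const subst.insertion_Var
lemmas substitute_hom = substitute_simps[folded substitute_def]

lemma eval_at_diff: "eval_at x (f - g) = eval_at x f - eval_at x g"
  using eval_at_hom(1)[of x "f - g" g] by simp

lemma substitute_diff: "substitute p (f - g) = substitute p f - substitute p g"
  using substitute_hom(1)[of p "f - g" g] by simp

lemma eval_at_substitute: "eval_at x (substitute p f) = eval_at (\<lambda>i. eval_at x (p i)) f"
  by (simp add: eval_at_def eval.insertion_substitute)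

lemma substitute_substitute: "substitute p (substitute p' f) = substitute (\<lambda>i. substitute p (p' i)) f"
  using subst.insertion_substitute by (simp add: substitute_def)

lemma eval_at_permute_vars: "eval_at x (permute_vars \<sigma> f) = eval_at (\<lambda>i. x (\<sigma> i)) f"
  by (simp add: permute_vars_def eval_at_substitute eval_at_hom)

lemma single_single_power: "single (single i a) (1::complex) ^ k = single (single i (a * k)) 1"
  by (induction k) (auto simp: mult_single single_add[symmetric])

lemma Var_power: "Var i ^ k = single (single i k) 1"
  by (simp add: Var_def single_single_power)

lemma prod_single_1: "(\<Prod>i\<in>A. single (e i) (1::complex)) = single (\<Sum>i\<in>A. e i) 1"
  by (induction A rule: infinite_finite_induct) (auto simp: mult_single)

text \<open>Covers both substitutions that occur: renaming of variables (\<open>d = 1\<close>) and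
  the power map (\<sigma> the identity).\<close>

lemma substitute_single_monomials:
  assumes "\<And>i. p i = Var (\<sigma> i) ^ d"
  shows "substitute p (single m c) = single (\<Sum>i\<in>keys m. single (\<sigma> i) (d * lookup m i)) c"
proof -
  have "substitute p (single m c) = Const c * (\<Prod>i\<in>keys m. single (single (\<sigma> i) (d * lookup m i)) 1)"
    by (simp add: substitute_def subst.insertion_single mon_val_def assms Var_power single_single_power)
  then show ?thesis
    by (simp add: prod_single_1 Const_def mult_single)
qed

lemma lookup_sum_single_inj:
  fixes m :: "nat \<Rightarrow>\<^sub>0 nat" and d :: nat
  assumes "inj \<sigma>"
  shows "lookup (\<Sum>i\<in>keys m. single (\<sigma> i) (d * lookup m i)) (\<sigma> j) = d * lookup m j"
proof -
  have "lookup (\<Sum>i\<in>keys m. single (\<sigma> i) (d * lookup m i)) (\<sigma> j) =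
      (\<Sum>i\<in>keys m. if i = j then d * lookup m i else 0)"
    by (simp add: lookup_sum lookup_single when_def inj_eq[OF assms(1)])
  also have "\<dots> = d * lookup m j"
    by (auto simp: sum.delta in_keys_iff)
  finally show ?thesis .
qed

text \<open>Renaming moves the exponent at i to \<sigma> i, so exactly one monomial lands on m: the
  one whose exponent is m precomposed with \<sigma>. Symmetry of f thereby becomes invariance of its
  coefficients.\<close>

lemma lookup_permute_vars:
  assumes "bij \<sigma>"
  shows "lookup (permute_vars \<sigma> f) m = lookup f (Poly_Mapping.map_key \<sigma> m)"
proof -
  note inj = bij_is_inj[OF assms]
  have *: "(\<Sum>i\<in>keys m'. single (\<sigma> i) (lookup m' i)) = m \<longleftrightarrow> m' = Poly_Mapping.map_key \<sigma> m" for m'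
  proof -
    let ?E = "\<Sum>i\<in>keys m'. single (\<sigma> i) (lookup m' i)"
    have E: "lookup ?E (\<sigma> j) = lookup m' j" for j
      using lookup_sum_single_inj[OF inj, of 1 m' j] by simp
    have "?E = m \<longleftrightarrow> (\<forall>j. lookup ?E (\<sigma> j) = lookup m (\<sigma> j))"
    proof (rule iffI, blast, rule poly_mapping_eqI)
      fix k
      assume eq: "\<forall>j. lookup ?E (\<sigma> j) = lookup m (\<sigma> j)"
      obtain j where "k = \<sigma> j"
        using bij_is_surj[OF assms] by blast
      with eq show "lookup ?E k = lookup m k"
        by simp
    qed
    also have "\<dots> \<longleftrightarrow> (\<forall>j. lookup m' j = lookup (Poly_Mapping.map_key \<sigma> m) j)"
      by (simp add: E map_key.rep_eq inj)
    also have "\<dots> \<longleftrightarrow> m' = Poly_Mapping.map_key \<sigma> m"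
      by (auto intro: poly_mapping_eqI)
    finally show ?thesis .
  qed
  have "permute_vars \<sigma> f = (\<Sum>m'\<in>keys f. permute_vars \<sigma> (single m' (lookup f m')))"
    by (subst poly_mapping_eq_sum_single[of f]) (simp add: permute_vars_def substitute_hom)
  also have "\<dots> = (\<Sum>m'\<in>keys f. single (\<Sum>i\<in>keys m'. single (\<sigma> i) (lookup m' i)) (lookup f m'))"
    unfolding permute_vars_def
    by (subst substitute_single_monomials[where d = 1 and \<sigma> = \<sigma>]) auto
  finally have "lookup (permute_vars \<sigma> f) m =
      (\<Sum>m'\<in>keys f. lookup f m' when m' = Poly_Mapping.map_key \<sigma> m)"
    by (simp add: lookup_sum lookup_single *)
  then show ?thesis
    unfolding when_def by (simp add: sum.delta in_keys_iff)
qed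

section \<open>Rings of polynomials and of symmetric polynomials\<close>

lemma polys_add: "f \<in> polys n \<Longrightarrow> g \<in> polys n \<Longrightarrow> f + g \<in> polys n"
  using keys_add[of f g] by (auto simp: polys_def)

lemma polys_mult:
  assumes "f \<in> polys n" "g \<in> polys n"
  shows "f * g \<in> polys n"
  unfolding polys_def mem_Collect_eq
proof
  fix m assume "m \<in> keys (f * g)"
  then obtain a b where "m = a + b" "a \<in> keys f" "b \<in> keys g"
    using keys_mult[of f g] by blast
  then show "keys m \<subseteq> {..<n}"
    using keys_add[of a b] assms by (fastforce simp: polys_def)
qed

lemma polys_Const [simp]: "Const c \<in> polys n"
  by (auto simp: polys_def Const_def)

lemma polys_0 [simp]: "0 \<in> polys n" and polys_1 [simp]: "1 \<in> polys n"
  by (auto simp: polys_def)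

lemma polys_Var [simp]: "i < n \<Longrightarrow> Var i \<in> polys n"
  by (auto simp: polys_def Var_def)

lemma polys_prod: "(\<And>a. a \<in> A \<Longrightarrow> f a \<in> polys n) \<Longrightarrow> prod f A \<in> polys n"
  by (induction A rule: infinite_finite_induct) (auto intro: polys_mult)

lemma polys_sum: "(\<And>a. a \<in> A \<Longrightarrow> f a \<in> polys n) \<Longrightarrow> sum f A \<in> polys n"
  by (induction A rule: infinite_finite_induct) (auto intro: polys_add)

lemma polys_power: "f \<in> polys n \<Longrightarrow> f ^ k \<in> polys n"
  by (induction k) (auto intro: polys_mult)

lemma polys_substitute:
  assumes "f \<in> polys n" "\<And>i. i < n \<Longrightarrow> p i \<in> polys n"
  shows "substitute p f \<in> polys n"
  unfolding substitute_def insertion_def using assms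
  by (intro polys_sum polys_mult polys_prod polys_power polys_Const) (auto simp: polys_def[of n])

lemma eval_at_cong:
  assumes "f \<in> polys n" "\<And>i. i < n \<Longrightarrow> x i = y i"
  shows "eval_at x f = eval_at y f"
  unfolding eval_at_def insertion_def using assms
  by (intro sum.cong prod.cong refl arg_cong2[where f = "(*)"]) (fastforce simp: polys_def)

lemma sym_polysI:
  assumes "f \<in> polys n" "\<And>\<sigma>. \<sigma> permutes {..<n} \<Longrightarrow> permute_vars \<sigma> f = f"
  shows "f \<in> sym_polys n"
  using assms by (simp add: sym_polys_def)

lemma sym_polys_mult: "f \<in> sym_polys n \<Longrightarrow> g \<in> sym_polys n \<Longrightarrow> f * g \<in> sym_polys n"
  by (auto simp: sym_polys_def polys_mult permute_vars_def substitute_hom)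

lemma sym_polys_1 [simp]: "1 \<in> sym_polys n"
  by (auto simp: sym_polys_def permute_vars_def substitute_hom)

lemma sym_polys_prod: "(\<And>a. a \<in> A \<Longrightarrow> f a \<in> sym_polys n) \<Longrightarrow> prod f A \<in> sym_polys n"
  by (induction A rule: infinite_finite_induct) (auto intro: sym_polys_mult)

lemma subspace_sym_polys: "cpoly.subspace (sym_polys n)"
  unfolding cpoly.subspace_def scale_def
  by (auto simp: sym_polys_def permute_vars_def substitute_hom polys_add polys_mult)

lemma sym_polys_substitute_power:
  assumes "f \<in> sym_polys n"
  shows "substitute (\<lambda>i. Var i ^ d) f \<in> sym_polys n"
proof (rule sym_polysI)
  show "substitute (\<lambda>i. Var i ^ d) f \<in> polys n"
    using assms by (intro polys_substitute polys_power) (auto simp: sym_polys_def)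
  fix \<sigma> assume "\<sigma> permutes {..<n}"
  then have "substitute (\<lambda>i. Var i ^ d) (permute_vars \<sigma> f) = substitute (\<lambda>i. Var i ^ d) f"
    using assms by (simp add: sym_polys_def)
  then show "permute_vars \<sigma> (substitute (\<lambda>i. Var i ^ d) f) = substitute (\<lambda>i. Var i ^ d) f"
    by (simp add: permute_vars_def substitute_substitute substitute_hom)
qed

text \<open>Building block of the separating polynomials: its value at y is 0 exactly when c is one
  of the first n coordinates of y.\<close>

lemma sym_polys_prod_Const_minus_Var: "(\<Prod>i<n. Const c - Var i) \<in> sym_polys n"
proof (rule sym_polysI)
  have "Const c - Var i \<in> polys n" if "i < n" for i
    using polys_add[of "Const c" n "Const (-1) * Var i"] that
    by (simp add: polys_mult) (simp add: Const_def single_uminus)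
  then show "(\<Prod>i<n. Const c - Var i) \<in> polys n"
    by (intro polys_prod) auto
  fix \<sigma> assume *: "\<sigma> permutes {..<n}"
  show "permute_vars \<sigma> (\<Prod>i<n. Const c - Var i) = (\<Prod>i<n. Const c - Var i)"
    by (subst (2) prod.permute[OF *])
       (simp add: permute_vars_def substitute_hom substitute_diff)
qed

lemma eval_at_sym_permute:
  assumes "f \<in> sym_polys n" "\<sigma> permutes {..<n}"
  shows "eval_at (\<lambda>i. x (\<sigma> i)) f = eval_at x f"
  using assms eval_at_permute_vars[of x \<sigma> f] by (simp add: sym_polys_def)

lemma lookup_sym_permute:
  assumes "f \<in> sym_polys n" "\<sigma> permutes {..<n}"
  shows "lookup f (Poly_Mapping.map_key \<sigma> m) = lookup f m"
  using assms lookup_permute_vars[OF permutes_bij[OF assms(2)], of f m] by (simp add: sym_polys_def)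

section \<open>Leading terms\<close>

abbreviation expo :: "nat list \<Rightarrow> (nat \<Rightarrow>\<^sub>0 nat)" where
  "expo \<equiv> Poly_Mapping.nth"

lemma lookup_expo: "lookup (expo l) i = (if i < length l then l ! i else 0)"
  by (simp add: lookup_nth nth_default_def)

declare lookup_nth [simp del]

text \<open>The coefficients n, n - 1, ..., 1 count in how many initial segments a position lies, so
  this is the sum of all partial sums, the quantities compared by dominance.\<close>

definition wt :: "nat \<Rightarrow> (nat \<Rightarrow>\<^sub>0 nat) \<Rightarrow> nat" where
  "wt n m = (\<Sum>i<n. (n - i) * lookup m i)"

lemma wt_add: "wt n (a + b) = wt n a + wt n b"
  by (simp add: wt_def lookup_add distrib_left sum.distrib)

lemma wt_expo:
  assumes "length l = n"
  shows "wt n (expo l) = (\<Sum>i\<le>n. sum_list (take i l))"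
proof -
  have "sum_list (take i l) = (\<Sum>j<n. if j < i then l ! j else 0)" if "i \<le> n" for i
  proof -
    have "sum_list (take i l) = (\<Sum>j<i. l ! j)"
      using that assms by (simp add: sum_list_sum_nth atLeast0LessThan)
    also have "\<dots> = (\<Sum>j<n. if j < i then l ! j else 0)"
      using that by (intro sum.mono_neutral_cong_left) auto
    finally show ?thesis .
  qed
  then have "(\<Sum>i\<le>n. sum_list (take i l)) = (\<Sum>i\<le>n. \<Sum>j<n. if j < i then l ! j else 0)"
    by simp
  also have "\<dots> = (\<Sum>j<n. \<Sum>i\<le>n. if j < i then l ! j else 0)"
    by (rule sum.swap)
  also have "\<dots> = (\<Sum>j<n. (n - j) * l ! j)"
  proof (rule sum.cong)
    fix j
    have "(\<Sum>i\<le>n. if j < i then l ! j else 0) = (\<Sum>i\<in>{j<..n}. l ! j)"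
      by (intro sum.mono_neutral_cong_right) auto
    then show "(\<Sum>i\<le>n. if j < i then l ! j else 0) = (n - j) * l ! j"
      by simp
  qed simp
  also have "\<dots> = wt n (expo l)"
    unfolding wt_def using assms by (intro sum.cong) (auto simp: lookup_expo)
  finally show ?thesis ..
qed

text \<open>The weight turns dominance into an inequality of numbers, and moving a larger entry to the
  front increases it, so that in an orbit of exponents the partition is the unique maximum.\<close>

lemma wt_dominated:
  assumes "l \<in> partitions n" "l' \<in> dominated n l"
  shows "wt n (expo l') < wt n (expo l)"
proof -
  have len: "length l = n" "length l' = n"
    using assms by (auto simp: dominated_def partitions_def)
  have le: "sum_list (take i l') \<le> sum_list (take i l)" if "i \<le> n" for i
    using assms that by (auto simp: dominated_def)
  have "wt n (expo l') \<le> wt n (expo l)"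
    unfolding wt_expo[OF len(1)] wt_expo[OF len(2)] using le by (intro sum_mono) auto
  moreover have "wt n (expo l') \<noteq> wt n (expo l)"
  proof
    assume eq: "wt n (expo l') = wt n (expo l)"
    \<comment> \<open>Termwise inequalities with equal totals are equalities; the entries are then
      recovered as differences of partial sums.\<close>
    have *: "sum_list (take i l') = sum_list (take i l)" if "i \<le> n" for i
      using sum_mono_inv[of "\<lambda>i. sum_list (take i l')" "{..n}" "\<lambda>i. sum_list (take i l)" i]
        eq le that len by (simp add: wt_expo)
    have "l' ! i = l ! i" if "i < n" for i
      using *[of i] *[of "Suc i"] that len by (simp add: take_Suc_conv_app_nth)
    then have "l' = l"
      using len by (intro nth_equalityI) auto
    then show False
      using assms by (auto simp: dominated_def)
  qed
  ultimately show ?thesis by simp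
qed

lemma wt_swap:
  assumes "Suc i < n" "lookup m i < lookup m (Suc i)"
  shows "wt n m < wt n (Poly_Mapping.map_key (Transposition.transpose i (Suc i)) m)"
proof -
  define R where "R = {..<n} - {i, Suc i}"
  have split: "(\<Sum>j<n. f j) = f i + f (Suc i) + sum f R" for f :: "nat \<Rightarrow> nat"
  proof -
    have "{..<n} = insert i (insert (Suc i) R)"
      using assms(1) by (auto simp: R_def)
    moreover have "finite R" "i \<notin> R" "Suc i \<notin> R"
      by (auto simp: R_def)
    ultimately show ?thesis by (simp add: add.assoc)
  qed
  let ?t = "Transposition.transpose i (Suc i)"
  have inj: "inj ?t" by simp
  have "(\<Sum>j\<in>R. (n - j) * lookup m (?t j)) = (\<Sum>j\<in>R. (n - j) * lookup m j)"
    by (intro sum.cong) (auto simp: R_def transpose_apply_other)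
  \<comment> \<open>Adjacent positions differ by one in their coefficient, so the swap gains exactly
    \<open>lookup m (Suc i) - lookup m i\<close>.\<close>
  moreover have "n - i = Suc (n - Suc i)"
    using assms(1) by simp
  ultimately show ?thesis
    using assms(2) unfolding wt_def by (subst (1 2) split) (simp add: map_key.rep_eq inj)
qed

lemma expo_if_antimono:
  assumes "keys m \<subseteq> {..<n}" "\<And>i. Suc i < n \<Longrightarrow> lookup m (Suc i) \<le> lookup m i"
  obtains l where "l \<in> partitions n" "m = expo l"
proof
  let ?l = "map (lookup m) [0..<n]"
  show "?l \<in> partitions n"
    using assms(2) by (auto simp: partitions_def sorted_wrt_iff_nth_Suc_transp transp_def)
  show "m = expo ?l"
    using assms(1) by (intro poly_mapping_eqI) (auto simp: lookup_expo in_keys_iff)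
qed

section \<open>Orbits of exponents under permutation of the variables\<close>

definition expo_orbit :: "nat \<Rightarrow> nat list \<Rightarrow> (nat \<Rightarrow>\<^sub>0 nat) set" where
  "expo_orbit n l = {Poly_Mapping.map_key \<sigma> (expo l) |\<sigma>. \<sigma> permutes {..<n}}"

lemma finite_expo_orbit: "finite (expo_orbit n l)"
  by (auto simp: expo_orbit_def setcompr_eq_image finite_permutations)

lemma map_key_expo_orbit:
  assumes "\<sigma> permutes {..<n}" "m \<in> expo_orbit n l"
  shows "Poly_Mapping.map_key \<sigma> m \<in> expo_orbit n l"
proof -
  obtain \<tau> where \<tau>: "m = Poly_Mapping.map_key \<tau> (expo l)" "\<tau> permutes {..<n}"
    using assms(2) by (auto simp: expo_orbit_def)
  then have "Poly_Mapping.map_key \<sigma> m = Poly_Mapping.map_key (\<tau> \<circ> \<sigma>) (expo l)"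
    using assms(1) by (simp add: map_key_compose permutes_inj)
  then show ?thesis
    using permutes_compose[OF assms(1) \<tau>(2)] by (auto simp: expo_orbit_def)
qed

lemma map_key_expo_orbit_iff:
  assumes "\<sigma> permutes {..<n}"
  shows "Poly_Mapping.map_key \<sigma> m \<in> expo_orbit n l \<longleftrightarrow> m \<in> expo_orbit n l"
proof
  assume "Poly_Mapping.map_key \<sigma> m \<in> expo_orbit n l"
  then have "Poly_Mapping.map_key (inv \<sigma>) (Poly_Mapping.map_key \<sigma> m) \<in> expo_orbit n l"
    by (rule map_key_expo_orbit[OF permutes_inv[OF assms]])
  moreover have "Poly_Mapping.map_key (inv \<sigma>) (Poly_Mapping.map_key \<sigma> m) = m"
    using permutes_inj[OF assms] permutes_inj[OF permutes_inv[OF assms]]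
    by (simp add: map_key_compose permutes_inv_o[OF assms] id_def map_key_id)
  ultimately show "m \<in> expo_orbit n l" by simp
qed (rule map_key_expo_orbit[OF assms])

lemma keys_expo_orbit:
  assumes "length l = n" "m \<in> expo_orbit n l"
  shows "keys m \<subseteq> {..<n}"
proof
  fix i assume "i \<in> keys m"
  moreover obtain \<sigma> where \<sigma>: "m = Poly_Mapping.map_key \<sigma> (expo l)" "\<sigma> permutes {..<n}"
    using assms(2) by (auto simp: expo_orbit_def)
  ultimately have "lookup (expo l) (\<sigma> i) \<noteq> 0"
    by (simp add: in_keys_iff map_key.rep_eq permutes_inj)
  then have "\<sigma> i < n"
    using assms(1) by (auto simp: lookup_expo split: if_splits)
  then show "i \<in> {..<n}"
    using permutes_in_image[OF \<sigma>(2), of i] by simp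
qed

text \<open>Both lists are sorted arrangements of one multiset. They are reversed because uniqueness
  of sorting is available for ascending lists.\<close>

lemma partition_in_expo_orbit_unique:
  assumes "l \<in> partitions n" "l' \<in> partitions n" "expo l' \<in> expo_orbit n l"
  shows "l' = l"
proof -
  have len: "length l = n" "length l' = n"
    using assms by (auto simp: partitions_def)
  obtain \<sigma> where \<sigma>: "expo l' = Poly_Mapping.map_key \<sigma> (expo l)" "\<sigma> permutes {..<n}"
    using assms(3) by (auto simp: expo_orbit_def)
  have nth: "l' ! i = l ! \<sigma> i" if "i < n" for i
  proof -
    have "lookup (expo l') i = lookup (expo l) (\<sigma> i)"
      using \<sigma> by (simp add: map_key.rep_eq permutes_inj)
    then show ?thesis
      using that permutes_in_image[OF \<sigma>(2), of i] len by (simp add: lookup_expo)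
  qed
  have "mset l' = mset (map (\<lambda>i. l ! \<sigma> i) [0..<n])"
    using nth len by (intro arg_cong[where f = mset] nth_equalityI) auto
  also have "\<dots> = image_mset (\<lambda>i. l ! i) (image_mset \<sigma> (mset_set {..<n}))"
    by (simp add: multiset.map_comp comp_def atLeast0LessThan)
  also have "image_mset \<sigma> (mset_set {..<n}) = mset_set {..<n}"
    using permutes_imp_bij[OF \<sigma>(2)] permutes_inj_on[OF \<sigma>(2)]
    by (simp add: image_mset_mset_set bij_betw_def)
  also have "image_mset (\<lambda>i. l ! i) (mset_set {..<n}) = mset (map (\<lambda>i. l ! i) [0..<n])"
    by (simp add: atLeast0LessThan)
  also have "\<dots> = mset l"
    using len map_nth[of l] by simp
  finally have "mset (rev l') = mset (rev l)" by simp
  moreover have "sorted (rev l')" "sorted (rev l)"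
    using assms by (auto simp: partitions_def sorted_wrt_rev)
  ultimately have "rev l' = rev l"
    by (metis properties_for_sort)
  then show ?thesis by simp
qed

text \<open>An element of maximal weight in the finite orbit admits no improving adjacent swap, so
  it is weakly decreasing and hence equals \<open>expo l\<close>. Every other element thus falls
  short of the maximum.\<close>

lemma wt_expo_orbit:
  assumes "l \<in> partitions n" "m \<in> expo_orbit n l" "m \<noteq> expo l"
  shows "wt n m < wt n (expo l)"
proof -
  have max: "b = expo l" if b: "b \<in> expo_orbit n l" "\<And>m. m \<in> expo_orbit n l \<Longrightarrow> wt n m \<le> wt n b" for b
  proof -
    have "lookup b (Suc i) \<le> lookup b i" if "Suc i < n" for i
    proof (rule ccontr)
      assume "\<not> lookup b (Suc i) \<le> lookup b i"
      then have "wt n b < wt n (Poly_Mapping.map_key (Transposition.transpose i (Suc i)) b)"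
        using that by (intro wt_swap) auto
      moreover have "Poly_Mapping.map_key (Transposition.transpose i (Suc i)) b \<in> expo_orbit n l"
        using that b(1) by (intro map_key_expo_orbit permutes_swap_id) auto
      ultimately show False
        using b(2) by fastforce
    qed
    then obtain l' where "l' \<in> partitions n" "b = expo l'"
      using expo_if_antimono[of b n] keys_expo_orbit[OF _ b(1)] assms(1) by (auto simp: partitions_def)
    then show ?thesis
      using partition_in_expo_orbit_unique[OF assms(1)] b(1) by auto
  qed
  let ?W = "wt n ` expo_orbit n l"
  have "Max ?W \<in> ?W"
    using finite_expo_orbit assms(2) by (intro Max_in) auto
  then obtain b where "b \<in> expo_orbit n l" "wt n b = Max ?W"
    by force
  then have b: "b \<in> expo_orbit n l" "\<And>m. m \<in> expo_orbit n l \<Longrightarrow> wt n m \<le> wt n b"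
    using finite_expo_orbit by auto
  have "wt n m \<noteq> wt n b"
    using max[of m] b assms(2,3) by auto
  then show ?thesis
    using b(2)[OF assms(2)] max[OF b] by simp
qed

text \<open>Renaming by \<sigma> precomposes exponents with the inverse of \<sigma>. The inverse
  here matches the convention of \<open>expo_orbit\<close>; as \<sigma> runs through a group, the
  same orbit results.\<close>

lemma permute_vars_inv_single:
  assumes "bij \<sigma>"
  shows "permute_vars (inv \<sigma>) (single m c) = single (Poly_Mapping.map_key \<sigma> m) c"
proof (rule poly_mapping_eqI)
  fix m'
  have "Poly_Mapping.map_key (inv \<sigma>) m' = m \<longleftrightarrow> Poly_Mapping.map_key \<sigma> m = m'"
  proof -
    have inj: "inj \<sigma>" "inj (inv \<sigma>)" "\<sigma> \<circ> inv \<sigma> = id" "inv \<sigma> \<circ> \<sigma> = id"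
      using assms by (auto simp: bij_is_inj bij_imp_bij_inv surj_iff[symmetric] bij_is_surj)
    have "Poly_Mapping.map_key \<sigma> (Poly_Mapping.map_key (inv \<sigma>) m) = m"
      "Poly_Mapping.map_key (inv \<sigma>) (Poly_Mapping.map_key \<sigma> m) = m" for m :: "nat \<Rightarrow>\<^sub>0 nat"
      by (simp_all add: map_key_compose inj) (simp_all add: id_def map_key_id)
    then show ?thesis by metis
  qed
  then show "lookup (permute_vars (inv \<sigma>) (single m c)) m' = lookup (single (Poly_Mapping.map_key \<sigma> m) c) m'"
    using assms by (auto simp: lookup_permute_vars bij_imp_bij_inv lookup_single when_def)
qed

text \<open>Coinciding monomials are already merged in the set summed by
  \<open>monomial_sym\<close>, and \<open>single\<close> with coefficient 1 is injective, so this
  set corresponds one to one to the orbit.\<close>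

lemma monomial_sym_eq_sum:
  assumes "length l = n"
  shows "monomial_sym n l = (\<Sum>m\<in>expo_orbit n l. single m 1)"
proof -
  have "(\<Prod>i<n. Var i ^ (l ! i)) = single (\<Sum>i<n. single i (l ! i)) 1"
    by (simp add: Var_power prod_single_1)
  also have "(\<Sum>i<n. single i (l ! i)) = expo l"
    using assms by (intro poly_mapping_eqI)
      (simp add: lookup_sum lookup_single when_def lookup_expo)
  finally have *: "(\<Prod>i<n. Var i ^ (l ! i)) = single (expo l) 1" .
  have "{permute_vars \<sigma> (\<Prod>i<n. Var i ^ (l ! i)) | \<sigma>. \<sigma> permutes {..<n}} = (\<lambda>m. single m 1) ` expo_orbit n l"
  proof (intro equalityI subsetI)
    fix f assume "f \<in> {permute_vars \<sigma> (\<Prod>i<n. Var i ^ (l ! i)) | \<sigma>. \<sigma> permutes {..<n}}"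
    then obtain \<sigma> where \<sigma>: "\<sigma> permutes {..<n}" "f = permute_vars \<sigma> (single (expo l) 1)"
      unfolding * by blast
    then have "f = single (Poly_Mapping.map_key (inv \<sigma>) (expo l)) 1"
      using permute_vars_inv_single[OF permutes_bij[OF permutes_inv[OF \<sigma>(1)]], of "expo l" 1]
      by (simp add: permutes_inv_inv[OF \<sigma>(1)])
    then show "f \<in> (\<lambda>m. single m 1) ` expo_orbit n l"
      using permutes_inv[OF \<sigma>(1)] by (auto simp: expo_orbit_def)
  next
    fix f :: cpoly assume "f \<in> (\<lambda>m. single m 1) ` expo_orbit n l"
    then obtain \<sigma> where \<sigma>: "\<sigma> permutes {..<n}" "f = single (Poly_Mapping.map_key \<sigma> (expo l)) 1"
      by (auto simp: expo_orbit_def)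
    then have "f = permute_vars (inv \<sigma>) (single (expo l) 1)"
      by (simp add: permute_vars_inv_single permutes_bij)
    then show "f \<in> {permute_vars \<sigma> (\<Prod>i<n. Var i ^ (l ! i)) | \<sigma>. \<sigma> permutes {..<n}}"
      unfolding * using permutes_inv[OF \<sigma>(1)] by blast
  qed
  moreover have "inj_on (\<lambda>m. single m (1::complex)) (expo_orbit n l)"
    by (rule inj_onI) (metis keys_single singleton_inject one_neq_zero)
  ultimately show ?thesis
    by (simp add: monomial_sym_def sum.reindex)
qed

lemma lookup_monomial_sym:
  assumes "length l = n"
  shows "lookup (monomial_sym n l) m = (if m \<in> expo_orbit n l then 1 else 0)"
  using finite_expo_orbit[of n l] by (simp add: monomial_sym_eq_sum[OF assms] lookup_sum lookup_single when_def)

lemma keys_monomial_sym: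
  assumes "length l = n"
  shows "keys (monomial_sym n l) = expo_orbit n l"
  by (auto simp: in_keys_iff lookup_monomial_sym[OF assms] split: if_splits)

lemma monomial_sym_in_sym_polys:
  assumes "length l = n"
  shows "monomial_sym n l \<in> sym_polys n"
proof (rule sym_polysI)
  show "monomial_sym n l \<in> polys n"
    using keys_expo_orbit[OF assms] by (simp add: polys_def keys_monomial_sym[OF assms])
  fix \<sigma> assume \<sigma>: "\<sigma> permutes {..<n}"
  show "permute_vars \<sigma> (monomial_sym n l) = monomial_sym n l"
    using \<sigma> by (intro poly_mapping_eqI)
      (simp add: lookup_permute_vars permutes_bij lookup_monomial_sym[OF assms] map_key_expo_orbit_iff)
qed

text \<open>A multiplicative filtration by weight. The strict bound makes level 0 the zero space,
  where the induction in \<open>sym_polys_generated\<close> starts.\<close>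

definition low_polys :: "nat \<Rightarrow> nat \<Rightarrow> cpoly set" where
  "low_polys n N = {f. \<forall>m\<in>keys f. wt n m < N}"

lemma low_polys_0 [simp]: "low_polys n 0 = {0}"
proof -
  have "f = 0" if "keys f = {}" for f :: cpoly
    using that by (intro poly_mapping_eqI) (auto simp: in_keys_iff)
  then show ?thesis by (auto simp: low_polys_def)
qed

lemma low_polys_mult:
  assumes "f \<in> low_polys n N" "g \<in> low_polys n M"
  shows "f * g \<in> low_polys n (N + M)"
  unfolding low_polys_def mem_Collect_eq
proof
  fix m assume "m \<in> keys (f * g)"
  then obtain a b where m: "m = a + b" "a \<in> keys f" "b \<in> keys g"
    using keys_mult[of f g] by blast
  then have "wt n a < N" "wt n b < M"
    using assms by (auto simp: low_polys_def)
  then show "wt n m < N + M"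
    by (simp add: m wt_add)
qed

lemma single_in_low_polys: "wt n m < N \<Longrightarrow> single m c \<in> low_polys n N"
  by (simp add: low_polys_def)

lemma single_mult_low_polys:
  assumes "f \<in> low_polys n N"
  shows "single m c * f \<in> low_polys n (wt n m + N)"
  unfolding low_polys_def mem_Collect_eq
proof
  fix m' assume "m' \<in> keys (single m c * f)"
  then obtain a b where m: "m' = a + b" "a \<in> keys (single m c)" "b \<in> keys f"
    using keys_mult[of "single m c" f] by blast
  then have "a = m" "wt n b < N"
    using assms by (auto simp: low_polys_def split: if_splits)
  then show "wt n m' < wt n m + N"
    by (simp add: m wt_add)
qed

lemma subspace_low_polys: "cpoly.subspace (low_polys n N)"
proof -
  have "f + g \<in> low_polys n N" if "f \<in> low_polys n N" "g \<in> low_polys n N" for f g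
    using that keys_add[of f g] by (auto simp: low_polys_def)
  moreover have "scale c f \<in> low_polys n N" if "f \<in> low_polys n N" for c f
    using single_mult_low_polys[OF that, of 0 c] by (simp add: scale_def Const_def wt_def)
  moreover have "0 \<in> low_polys n N"
    by (simp add: low_polys_def)
  ultimately show ?thesis
    unfolding cpoly.subspace_def by blast
qed

text \<open>Different exponents can have equal weight, so the definition demands that one monomial
  alone attains the top weight.\<close>

definition has_leading_exponent :: "nat \<Rightarrow> cpoly \<Rightarrow> (nat \<Rightarrow>\<^sub>0 nat) \<Rightarrow> bool" where
  "has_leading_exponent n f m \<longleftrightarrow> (\<exists>c. c \<noteq> 0 \<and> f - single m c \<in> low_polys n (wt n m))"

text \<open>With s and u the leading terms of f and g, every summand on the right keeps a factor of
  lower weight.\<close>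

lemma mult_minus_mult_eq:
  fixes f g s u :: "'a::comm_ring"
  shows "f * g - s * u = (f - s) * (g - u) + s * (g - u) + u * (f - s)"
  by (simp add: algebra_simps)

lemma has_leading_exponent_mult:
  assumes "has_leading_exponent n f a" "has_leading_exponent n g b"
  shows "has_leading_exponent n (f * g) (a + b)"
proof -
  obtain c e where c: "c \<noteq> 0" "f - single a c \<in> low_polys n (wt n a)"
    and e: "e \<noteq> 0" "g - single b e \<in> low_polys n (wt n b)"
    using assms by (auto simp: has_leading_exponent_def)
  have "f * g - single (a + b) (c * e) =
      (f - single a c) * (g - single b e) + single a c * (g - single b e) + single b e * (f - single a c)"
    unfolding mult_single[symmetric] by (rule mult_minus_mult_eq)
  also have "\<dots> \<in> low_polys n (wt n a + wt n b)"
    using low_polys_mult[OF c(2) e(2)] single_mult_low_polys[OF c(2), of b e]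
      single_mult_low_polys[OF e(2), of a c]
    by (intro cpoly.subspace_add[OF subspace_low_polys]) (auto simp: add.commute)
  finally show ?thesis
    using c(1) e(1) by (auto simp: has_leading_exponent_def wt_add intro!: exI[of _ "c * e"])
qed

lemma monomial_sym_minus_leading:
  assumes "l \<in> partitions n"
  shows "monomial_sym n l - single (expo l) 1 \<in> low_polys n (wt n (expo l))"
proof -
  have len: "length l = n"
    using assms by (simp add: partitions_def)
  have "expo l \<in> expo_orbit n l"
    unfolding expo_orbit_def using permutes_id[of "{..<n}"] by (force simp: map_key_id id_def)
  then have "keys (monomial_sym n l - single (expo l) 1) \<subseteq> expo_orbit n l - {expo l}"
    by (auto simp: in_keys_iff lookup_minus lookup_monomial_sym[OF len] lookup_single when_def split: if_splits)
  then show ?thesis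
    using wt_expo_orbit[OF assms] by (auto simp: low_polys_def)
qed

text \<open>An exponent in the orbit of a dominated partition weighs at most as much as that
  partition, which weighs less than l.\<close>

lemma has_leading_exponent_if_highest_partition:
  assumes "l \<in> partitions n" "has_highest_partition n g l"
  shows "has_leading_exponent n g (expo l)"
proof -
  let ?L = "low_polys n (wt n (expo l))"
  note sub = subspace_low_polys[of n "wt n (expo l)"]
  obtain c where c: "c l \<noteq> 0" "g = scale (c l) (monomial_sym n l)
      + (\<Sum>l'\<in>dominated n l. scale (c l') (monomial_sym n l'))"
    using assms(2) by (auto simp: has_highest_partition_def)
  have "monomial_sym n l' \<in> ?L" if "l' \<in> dominated n l" for l'
  proof -
    have l': "l' \<in> partitions n"
      using that by (simp add: dominated_def)
    have "wt n m < wt n (expo l)" if "m \<in> expo_orbit n l'" for m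
      using wt_dominated[OF assms(1) \<open>l' \<in> dominated n l\<close>] wt_expo_orbit[OF l' that]
      by (cases "m = expo l'") auto
    then show ?thesis
      using l' by (simp add: low_polys_def keys_monomial_sym partitions_def)
  qed
  then have "(\<Sum>l'\<in>dominated n l. scale (c l') (monomial_sym n l')) \<in> ?L"
    by (intro cpoly.subspace_sum[OF sub] cpoly.subspace_scale[OF sub])
  moreover have "scale (c l) (monomial_sym n l - single (expo l) 1) \<in> ?L"
    using monomial_sym_minus_leading[OF assms(1)] by (rule cpoly.subspace_scale[OF sub])
  ultimately have "scale (c l) (monomial_sym n l - single (expo l) 1)
      + (\<Sum>l'\<in>dominated n l. scale (c l') (monomial_sym n l')) \<in> ?L"
    by (rule cpoly.subspace_add[OF sub, rotated])
  also have "scale (c l) (monomial_sym n l - single (expo l) 1) = scale (c l) (monomial_sym n l) - single (expo l) (c l)"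
    by (simp add: cpoly.scale_right_diff_distrib) (simp add: scale_def Const_def mult_single)
  finally show ?thesis
    using c by (auto simp: has_leading_exponent_def algebra_simps intro!: exI[of _ "c l"])
qed

text \<open>Written as a sum of \<open>single\<close> terms because this is the exponent that
  \<open>substitute_single_monomials\<close> produces.\<close>

definition dilate :: "nat \<Rightarrow> (nat \<Rightarrow>\<^sub>0 nat) \<Rightarrow> (nat \<Rightarrow>\<^sub>0 nat)" where
  "dilate d m = (\<Sum>i\<in>keys m. single i (d * lookup m i))"

lemma lookup_dilate [simp]: "lookup (dilate d m) i = d * lookup m i"
  using lookup_sum_single_inj[of "\<lambda>i. i" d m i] by (simp add: dilate_def)

lemma substitute_power_single:
  "substitute (\<lambda>i. Var i ^ d) (single m c) = single (dilate d m) c"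
  using substitute_single_monomials[of "\<lambda>i. Var i ^ d" "\<lambda>i. i" d m c] by (simp add: dilate_def)

lemma wt_dilate: "wt n (dilate d m) = d * wt n m"
  by (simp add: wt_def sum_distrib_left ac_simps)

lemma has_leading_exponent_substitute_power:
  assumes "d > 0" "has_leading_exponent n f m"
  shows "has_leading_exponent n (substitute (\<lambda>i. Var i ^ d) f) (dilate d m)"
proof -
  have low: "substitute (\<lambda>i. Var i ^ d) u \<in> low_polys n (d * N)" if "u \<in> low_polys n N" for u N
  proof -
    have "substitute (\<lambda>i. Var i ^ d) u = (\<Sum>m\<in>keys u. single (dilate d m) (lookup u m))"
      by (subst poly_mapping_eq_sum_single[of u]) (simp add: substitute_hom substitute_power_single)
    also have "\<dots> \<in> low_polys n (d * N)"
      using that assms(1) by (intro cpoly.subspace_sum[OF subspace_low_polys] single_in_low_polys)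
        (auto simp: wt_dilate low_polys_def)
    finally show ?thesis .
  qed
  obtain c where c: "c \<noteq> 0" "f - single m c \<in> low_polys n (wt n m)"
    using assms by (auto simp: has_leading_exponent_def)
  then show ?thesis
    using low[OF c(2)]
    by (auto simp: has_leading_exponent_def wt_dilate substitute_diff substitute_power_single)
qed

section \<open>Division of partitions and generation over the dilated symmetric polynomials\<close>

lemma partition_step:
  assumes "l \<in> partitions n"
  shows "lookup (expo l) (Suc i) \<le> lookup (expo l) i"
  using assms by (auto simp: partitions_def lookup_expo sorted_wrt_iff_nth_Suc_transp transp_def)

lemma partition_telescope:
  assumes "l \<in> partitions n" "i \<le> n"
  shows "lookup (expo l) i = (\<Sum>j=i..<n. lookup (expo l) j - lookup (expo l) (Suc j))"
  using assms(2)
proof (induction rule: inc_induct)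
  case base
  then show ?case using assms(1) by (simp add: lookup_expo partitions_def)
next
  case (step i)
  then show ?case
    using partition_step[OF assms(1), of i] by (simp add: sum.atLeast_Suc_lessThan)
qed

text \<open>Slimness bounds the consecutive differences, so each difference is divided by d with
  remainder; summing the quotients and the remainders back up gives the two partitions.\<close>

lemma partition_division:
  assumes "l \<in> partitions n" "d > 0" "n > 0"
  obtains v u where "v \<in> partitions n" "u \<in> slim_partitions n d" "expo l = dilate d (expo v) + expo u"
proof
  \<comment> \<open>\<open>lookup\<close> is 0 beyond the list, so the last difference is the last
    entry itself; the separate bound on that entry in \<open>slim_partitions\<close> thus becomes
    one of the n bounds on differences.\<close>
  define D where "D j = lookup (expo l) j - lookup (expo l) (Suc j)" for j
  let ?p = "\<lambda>f. map (\<lambda>i. \<Sum>j=i..<n. f (D j)) [0..<n]"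
  have part: "?p f \<in> partitions n" for f :: "nat \<Rightarrow> nat"
    by (auto simp: partitions_def sorted_wrt_iff_nth_Suc_transp transp_def intro!: sum_mono2)
  show "?p (\<lambda>x. x div d) \<in> partitions n"
    by (rule part)
  show "?p (\<lambda>x. x mod d) \<in> slim_partitions n d"
    using part assms(2,3) by (auto simp: slim_partitions_def sum.atLeast_Suc_lessThan)
  show "expo l = dilate d (expo (?p (\<lambda>x. x div d))) + expo (?p (\<lambda>x. x mod d))"
  proof (rule poly_mapping_eqI)
    fix i
    show "lookup (expo l) i = lookup (dilate d (expo (?p (\<lambda>x. x div d))) + expo (?p (\<lambda>x. x mod d))) i"
    proof (cases "i < n")
      case True
      then have "lookup (expo l) i = (\<Sum>j=i..<n. D j)"
        using partition_telescope[OF assms(1), of i] by (simp add: D_def)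
      also have "\<dots> = d * (\<Sum>j=i..<n. D j div d) + (\<Sum>j=i..<n. D j mod d)"
        by (simp add: sum_distrib_left flip: sum.distrib)
      finally show ?thesis
        using True by (simp add: lookup_add lookup_expo)
    next
      case False
      then show ?thesis
        using assms(1) by (simp add: lookup_add lookup_expo partitions_def)
    qed
  qed
qed

text \<open>A slim partition is determined by its n consecutive differences, the last one taken
  against 0, and all of them are below d.\<close>

lemma finite_slim_partitions: "finite (slim_partitions n d)" (is ?fin)
  and card_slim_partitions_le: "card (slim_partitions n d) \<le> d ^ n" (is ?card)
proof -
  let ?D = "\<lambda>l. \<lambda>i\<in>{..<n}. lookup (expo l) i - lookup (expo l) (Suc i)"
  let ?B = "{..<n} \<rightarrow>\<^sub>E {..<d}"
  have inj: "inj_on ?D (slim_partitions n d)"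
  proof (rule inj_onI)
    fix l l' assume l: "l \<in> slim_partitions n d" "l' \<in> slim_partitions n d" and eq: "?D l = ?D l'"
    have part: "l \<in> partitions n" "l' \<in> partitions n"
      using l by (auto simp: slim_partitions_def)
    have "l ! i = l' ! i" if "i < n" for i
    proof -
      have "lookup (expo l) j - lookup (expo l) (Suc j) = lookup (expo l') j - lookup (expo l') (Suc j)"
        if "j < n" for j
        using fun_cong[OF eq, of j] that by simp
      then have "lookup (expo l) i = lookup (expo l') i"
        using \<open>i < n\<close> by (subst (1 2) partition_telescope[of _ n]) (simp_all add: part)
      then show ?thesis
        using that part by (simp add: lookup_expo partitions_def)
    qed
    then show "l = l'"
      using part by (intro nth_equalityI) (auto simp: partitions_def)
  qed
  have "lookup (expo l) i - lookup (expo l) (Suc i) < d" if "l \<in> slim_partitions n d" "i < n" for l i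
  proof (cases "Suc i < n")
    case False
    with that have "i = n - 1" by simp
    with that False show ?thesis
      by (auto simp: slim_partitions_def lookup_expo partitions_def)
  qed (use that in \<open>auto simp: slim_partitions_def lookup_expo partitions_def\<close>)
  then have sub: "?D ` slim_partitions n d \<subseteq> ?B"
    by (intro image_subsetI) (simp add: restrict_PiE_iff)
  have fin: "finite ?B"
    by (intro finite_PiE) auto
  show ?fin
    using inj_on_finite[OF inj sub fin] .
  show ?card
    using card_inj_on_le[OF inj sub fin] by (simp add: card_PiE)
qed

text \<open>For finite S, the module generated by the \<open>g \<mu>\<close> over the ring of
  symmetric polynomials in the d-th powers of the variables.\<close>

definition dilated_span :: "nat \<Rightarrow> nat \<Rightarrow> 'i set \<Rightarrow> ('i \<Rightarrow> cpoly) \<Rightarrow> cpoly set" where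
  "dilated_span n d S g = {\<Sum>\<mu>\<in>S. substitute (\<lambda>i. Var i ^ d) (h \<mu>) * g \<mu> |h. \<forall>\<mu>\<in>S. h \<mu> \<in> sym_polys n}"

lemma subspace_dilated_span: "cpoly.subspace (dilated_span n d S g)"
  unfolding cpoly.subspace_def
proof (intro conjI ballI allI)
  let ?P = "substitute (\<lambda>i. Var i ^ d)"
  show "0 \<in> dilated_span n d S g"
    unfolding dilated_span_def using cpoly.subspace_0[OF subspace_sym_polys]
    by (auto simp: substitute_hom intro!: exI[of _ "\<lambda>_. 0"])
  fix f f' assume f: "f \<in> dilated_span n d S g"
  then obtain h where h: "f = (\<Sum>\<mu>\<in>S. ?P (h \<mu>) * g \<mu>)" "\<forall>\<mu>\<in>S. h \<mu> \<in> sym_polys n"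
    by (auto simp: dilated_span_def)
  { assume f': "f' \<in> dilated_span n d S g"
    then obtain h' where h': "f' = (\<Sum>\<mu>\<in>S. ?P (h' \<mu>) * g \<mu>)" "\<forall>\<mu>\<in>S. h' \<mu> \<in> sym_polys n"
      by (auto simp: dilated_span_def)
    have "f + f' = (\<Sum>\<mu>\<in>S. ?P (h \<mu> + h' \<mu>) * g \<mu>)"
      by (simp add: h h' substitute_hom distrib_right sum.distrib)
    then show "f + f' \<in> dilated_span n d S g"
      unfolding dilated_span_def using h(2) h'(2) cpoly.subspace_add[OF subspace_sym_polys]
      by (auto intro!: exI[of _ "\<lambda>\<mu>. h \<mu> + h' \<mu>"])
  }
  fix c
  have "scale c f = (\<Sum>\<mu>\<in>S. ?P (scale c (h \<mu>)) * g \<mu>)"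
    by (simp add: h substitute_hom scale_def sum_distrib_left mult.assoc)
  then show "scale c f \<in> dilated_span n d S g"
    unfolding dilated_span_def using h(2) cpoly.subspace_scale[OF subspace_sym_polys]
    by (auto intro!: exI[of _ "\<lambda>\<mu>. scale c (h \<mu>)"])
qed

text \<open>By symmetry a swapped exponent also occurs in f; if m were not weakly decreasing, an
  adjacent swap would exceed the maximal weight N.\<close>

lemma leading_exponent_partition:
  assumes "f \<in> sym_polys n" "f \<in> low_polys n (Suc N)" "m \<in> keys f" "wt n m = N"
  obtains l where "l \<in> partitions n" "m = expo l"
proof (rule expo_if_antimono[of m n])
  show "keys m \<subseteq> {..<n}"
    using assms by (auto simp: sym_polys_def polys_def)
  fix i assume i: "Suc i < n"
  show "lookup m (Suc i) \<le> lookup m i"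
  proof (rule ccontr)
    let ?m' = "Poly_Mapping.map_key (Transposition.transpose i (Suc i)) m"
    assume "\<not> lookup m (Suc i) \<le> lookup m i"
    then have "wt n m < wt n ?m'"
      using i by (intro wt_swap) auto
    moreover have "?m' \<in> keys f"
      using lookup_sym_permute[OF assms(1) permutes_swap_id, of i "Suc i" m] i assms(3)
      by (simp add: in_keys_iff)
    ultimately show False
      using assms(2,4) by (fastforce simp: low_polys_def)
  qed
qed (use that in blast)

text \<open>Every partition is the leading exponent of some symmetric element of the module,
  normalised to leading coefficient 1. Subtracting suitable multiples of these elements removes the
  top weight of f, and the induction is on a strict bound for the weights.\<close>

proposition sym_polys_generated:
  assumes d: "d > 0" and n: "n > 0"
    and g: "\<And>\<mu>. \<mu> \<in> slim_partitions n d \<Longrightarrow> g \<mu> \<in> sym_polys n \<and> has_highest_partition n (g \<mu>) \<mu>"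
    and f: "f \<in> sym_polys n"
  shows "f \<in> dilated_span n d (slim_partitions n d) g"
proof -
  let ?V = "dilated_span n d (slim_partitions n d) g"
  have basic: "\<exists>p. p \<in> ?V \<and> p \<in> sym_polys n \<and> p - single (expo l) 1 \<in> low_polys n (wt n (expo l))"
    if l: "l \<in> partitions n" for l
  proof -
    obtain v u where vu: "v \<in> partitions n" "u \<in> slim_partitions n d" "expo l = dilate d (expo v) + expo u"
      using partition_division[OF l d n] .
    \<comment> \<open>The family supported at u alone presents one product as an element of the
      module.\<close>
    let ?h = "\<lambda>\<mu>. if \<mu> = u then monomial_sym n v else 0"
    let ?p = "substitute (\<lambda>i. Var i ^ d) (monomial_sym n v) * g u"
    have v: "monomial_sym n v \<in> sym_polys n"
      using vu(1) by (intro monomial_sym_in_sym_polys) (simp add: partitions_def)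
    have "(\<Sum>\<mu>\<in>slim_partitions n d. substitute (\<lambda>i. Var i ^ d) (?h \<mu>) * g \<mu>) =
        (\<Sum>\<mu>\<in>slim_partitions n d. if \<mu> = u then ?p else 0)"
      by (intro sum.cong) (auto simp: substitute_hom)
    also have "\<dots> = ?p"
      using vu(2) finite_slim_partitions by simp
    finally have V: "?p \<in> ?V"
      unfolding dilated_span_def using v cpoly.subspace_0[OF subspace_sym_polys]
      by (auto intro!: exI[of _ ?h])
    have S: "?p \<in> sym_polys n"
      using v g[OF vu(2)] by (intro sym_polys_mult sym_polys_substitute_power) auto
    have "has_leading_exponent n (monomial_sym n v) (expo v)"
      using monomial_sym_minus_leading[OF vu(1)]
      by (auto simp: has_leading_exponent_def intro!: exI[of _ 1])
    moreover have "has_leading_exponent n (g u) (expo u)"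
      using g[OF vu(2)] vu(2) by (intro has_leading_exponent_if_highest_partition) (auto simp: slim_partitions_def)
    ultimately have "has_leading_exponent n ?p (expo l)"
      unfolding vu(3) using d by (intro has_leading_exponent_mult has_leading_exponent_substitute_power)
    then obtain c where c: "c \<noteq> 0" "?p - single (expo l) c \<in> low_polys n (wt n (expo l))"
      by (auto simp: has_leading_exponent_def)
    have "scale (inverse c) (?p - single (expo l) c) = scale (inverse c) ?p - single (expo l) 1"
      using c(1) by (simp add: cpoly.scale_right_diff_distrib) (simp add: scale_def Const_def mult_single)
    then have "scale (inverse c) ?p - single (expo l) 1 \<in> low_polys n (wt n (expo l))"
      using cpoly.subspace_scale[OF subspace_low_polys c(2), of "inverse c"] by simp
    then show ?thesis
      using cpoly.subspace_scale[OF subspace_dilated_span V] cpoly.subspace_scale[OF subspace_sym_polys S]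
      by blast
  qed
  have "f \<in> ?V" if "f \<in> sym_polys n" "f \<in> low_polys n N" for f N
    using that
  proof (induction N arbitrary: f)
    case 0
    then show ?case
      using cpoly.subspace_0[OF subspace_dilated_span] by simp
  next
    case (Suc N)
    \<comment> \<open>Several exponents may share the top weight N. All are partitions and are
      cancelled together; the correction for each of them has no other term of weight N.\<close>
    define T where "T = {m \<in> keys f. wt n m = N}"
    have "\<exists>p. p \<in> ?V \<and> p \<in> sym_polys n \<and> p - single m 1 \<in> low_polys n N" if "m \<in> T" for m
      using that leading_exponent_partition[OF Suc.prems, of m] basic unfolding T_def by auto metis
    then obtain p where p: "p m \<in> ?V" "p m \<in> sym_polys n" "p m - single m 1 \<in> low_polys n N" if "m \<in> T" for m
      by metis
    let ?s = "\<Sum>m\<in>T. scale (lookup f m) (p m)"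
    let ?low = "low_polys n N"
    have "(\<Sum>m\<in>T. scale (lookup f m) (p m - single m 1)) \<in> ?low"
      using p by (intro cpoly.subspace_sum[OF subspace_low_polys] cpoly.subspace_scale[OF subspace_low_polys]) auto
    moreover have "f - (\<Sum>m\<in>T. single m (lookup f m)) \<in> ?low"
      unfolding low_polys_def mem_Collect_eq
    proof
      fix m assume m: "m \<in> keys (f - (\<Sum>m\<in>T. single m (lookup f m)))"
      have "finite T" by (simp add: T_def)
      then have "lookup (\<Sum>m\<in>T. single m (lookup f m)) m = (if m \<in> T then lookup f m else 0)"
        by (simp add: lookup_sum lookup_single when_def)
      then have "m \<in> keys f" "m \<notin> T"
        using m by (auto simp: in_keys_iff lookup_minus split: if_splits)
      then show "wt n m < N"
        using Suc.prems(2) by (fastforce simp: T_def low_polys_def)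
    qed
    ultimately have "f - (\<Sum>m\<in>T. single m (lookup f m)) - (\<Sum>m\<in>T. scale (lookup f m) (p m - single m 1)) \<in> ?low"
      by (rule cpoly.subspace_diff[OF subspace_low_polys, rotated])
    also have "f - (\<Sum>m\<in>T. single m (lookup f m)) - (\<Sum>m\<in>T. scale (lookup f m) (p m - single m 1)) = f - ?s"
      by (simp add: cpoly.scale_right_diff_distrib sum_subtractf) (simp add: scale_def Const_def mult_single)
    finally have "f - ?s \<in> ?low" .
    moreover have "f - ?s \<in> sym_polys n"
      using Suc.prems p
      by (intro cpoly.subspace_diff[OF subspace_sym_polys] cpoly.subspace_sum[OF subspace_sym_polys]
          cpoly.subspace_scale[OF subspace_sym_polys]) auto
    ultimately have "f - ?s \<in> ?V"
      using Suc.IH by blast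
    moreover have "?s \<in> ?V"
      using p by (intro cpoly.subspace_sum[OF subspace_dilated_span] cpoly.subspace_scale[OF subspace_dilated_span]) auto
    ultimately have "f - ?s + ?s \<in> ?V"
      by (rule cpoly.subspace_add[OF subspace_dilated_span])
    then show ?case by simp
  qed
  moreover have "f \<in> low_polys n (Suc (Max (wt n ` keys f)))"
    by (auto simp: low_polys_def less_Suc_eq_le)
  ultimately show ?thesis
    using f by blast
qed

section \<open>Separation of points in the fibres of the power map\<close>

text \<open>A nontrivial relation would make one member redundant. The remaining ones, fewer than
  \<open>card A\<close>, would still span the indicator functions of the points of A, which are
  \<open>card A\<close> independent vectors.\<close>

lemma separating_family_injective:
  fixes w :: "'i \<Rightarrow> 'a \<Rightarrow> complex"
  assumes fin: "finite S" "finite A" and card: "card S \<le> card A"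
    and delta: "\<And>a. a \<in> A \<Longrightarrow> \<exists>c. \<forall>b\<in>A. (\<Sum>\<mu>\<in>S. c \<mu> * w \<mu> b) = (if b = a then 1 else 0)"
    and zero: "\<And>b. b \<in> A \<Longrightarrow> (\<Sum>\<mu>\<in>S. c \<mu> * w \<mu> b) = 0"
    and \<mu>: "\<mu> \<in> S"
  shows "c \<mu> = 0"
proof (rule ccontr)
  assume c: "c \<mu> \<noteq> 0"
  interpret fs: vector_space "\<lambda>(c::complex) (u :: 'a \<Rightarrow> complex) x. c * u x"
    by unfold_locales (auto simp: fun_eq_iff algebra_simps)
  have sum_app: "(\<Sum>x\<in>X. u x) b = (\<Sum>x\<in>X. u x b)" for X :: "'x set" and u :: "'x \<Rightarrow> 'a \<Rightarrow> complex" and b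
    by (induction X rule: infinite_finite_induct) auto
  \<comment> \<open>The functions live on the whole type; cutting them off outside A turns
    identities on A into identities of vectors.\<close>
  define W where "W \<mu> b = (if b \<in> A then w \<mu> b else 0)" for \<mu> b
  define \<delta> where "\<delta> a b = (if b = a then 1 else 0 :: complex)" for a b :: 'a
  let ?T = "W ` (S - {\<mu>})"
  have "W \<mu> = (\<Sum>\<nu>\<in>S - {\<mu>}. (\<lambda>b. (- c \<nu> / c \<mu>) * W \<nu> b))"
  proof
    fix b
    have "c \<mu> * w \<mu> b = - (\<Sum>\<nu>\<in>S - {\<mu>}. c \<nu> * w \<nu> b)" if "b \<in> A"
      using zero[OF that] \<mu> fin(1) by (simp add: sum.remove eq_neg_iff_add_eq_0)
    then have "w \<mu> b = - (\<Sum>\<nu>\<in>S - {\<mu>}. c \<nu> * w \<nu> b) / c \<mu>" if "b \<in> A"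
      using that c by (simp add: field_simps)
    then show "W \<mu> b = (\<Sum>\<nu>\<in>S - {\<mu>}. (\<lambda>b. (- c \<nu> / c \<mu>) * W \<nu> b)) b"
      by (auto simp: W_def sum_app sum_divide_distrib sum_negf)
  qed
  also have "\<dots> \<in> fs.span ?T"
    by (intro fs.span_sum fs.span_scale fs.span_base) auto
  finally have W: "W \<nu> \<in> fs.span ?T" if "\<nu> \<in> S" for \<nu>
    using that by (cases "\<nu> = \<mu>") (auto intro: fs.span_base)
  have "\<delta> a \<in> fs.span ?T" if a: "a \<in> A" for a
  proof -
    obtain e where e: "\<And>b. b \<in> A \<Longrightarrow> (\<Sum>\<mu>\<in>S. e \<mu> * w \<mu> b) = (if b = a then 1 else 0)"
      using delta[OF a] by blast
    have "\<delta> a = (\<Sum>\<nu>\<in>S. (\<lambda>b. e \<nu> * W \<nu> b))"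
    proof
      fix b
      show "\<delta> a b = (\<Sum>\<nu>\<in>S. (\<lambda>b. e \<nu> * W \<nu> b)) b"
        using e a by (cases "b \<in> A") (auto simp: sum_app \<delta>_def W_def)
    qed
    also have "\<dots> \<in> fs.span ?T"
      using W by (intro fs.span_sum fs.span_scale) auto
    finally show ?thesis .
  qed
  moreover have inj: "inj_on \<delta> A"
    by (rule inj_onI) (metis \<delta>_def one_neq_zero)
  moreover have "fs.independent (\<delta> ` A)"
  proof (rule fs.independent_if_scalars_zero)
    fix u v assume u: "(\<Sum>v\<in>\<delta> ` A. (\<lambda>b. u v * v b)) = 0" and "v \<in> \<delta> ` A"
    then obtain a where a: "a \<in> A" "v = \<delta> a"
      by blast
    have "0 = (\<Sum>v\<in>\<delta> ` A. (\<lambda>b. u v * v b)) a"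
      by (simp add: u)
    also have "\<dots> = (\<Sum>a'\<in>A. if a' = a then u (\<delta> a') else 0)"
      unfolding sum_app sum.reindex[OF inj] by (intro sum.cong) (auto simp: \<delta>_def)
    also have "\<dots> = u v"
      using a fin by simp
    finally show "u v = 0" ..
  qed (use fin in auto)
  ultimately have "card (\<delta> ` A) \<le> card ?T"
    using fin(1) by (intro conjunct2[OF fs.independent_span_bound]) auto
  also have "\<dots> \<le> card (S - {\<mu>})"
    using fin by (intro card_image_le) auto
  also have "\<dots> < card S"
    using fin \<mu> by (intro psubset_card_mono) auto
  also note card
  finally show False
    using card_image[OF inj] by simp
qed

section \<open>Roots of unity and the twisted points of a fibre\<close>

lemma primitive_root_power_inj:
  assumes "primitive_root_of_unity m z" "i < m" "j < m" "z ^ i = z ^ j"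
  shows "i = j"
proof -
  have z: "z \<noteq> 0"
    using assms(1) by (auto simp: primitive_root_of_unity_def power_0_left)
  have *: "i = j" if "i \<le> j" "j < m" "z ^ i = z ^ j" for i j
  proof -
    have "z ^ i * z ^ (j - i) = z ^ i * 1"
      using that power_add[of z i "j - i"] by simp
    then have "z ^ (j - i) = 1"
      using z by simp
    moreover have "j - i < m"
      using that by simp
    ultimately have "\<not> 0 < j - i"
      using assms(1) by (auto simp: primitive_root_of_unity_def)
    with that show ?thesis by simp
  qed
  show ?thesis
    using *[of i j] *[of j i] assms by (cases "i \<le> j") auto
qed

lemma primitive_root_power_mod:
  assumes "primitive_root_of_unity m z"
  shows "z ^ (i mod m) = z ^ i"
proof -
  have "z ^ i = z ^ (m * (i div m) + i mod m)"
    by simp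
  also have "\<dots> = z ^ (i mod m)"
    using assms by (simp only: power_add power_mult) (simp add: primitive_root_of_unity_def)
  finally show ?thesis ..
qed

text \<open>Imposed on the d-th powers of x, this puts the twists of x by powers of q into distinct
  orbits of the symmetric group.\<close>

definition generic_point :: "nat \<Rightarrow> (nat \<Rightarrow> complex) \<Rightarrow> bool" where
  "generic_point n x \<longleftrightarrow> (\<forall>i<n. x i \<noteq> 0) \<and> inj_on x {..<n}"

text \<open>Extensional functions make the set finite of size \<open>d ^ n\<close>, and distinct
  members differ at an index below n.\<close>

definition twists :: "nat \<Rightarrow> nat \<Rightarrow> (nat \<Rightarrow> nat) set" where
  "twists n d = {..<n} \<rightarrow>\<^sub>E {..<d}"

lemma eval_at_substitute_power:
  "eval_at x (substitute (\<lambda>i. Var i ^ d) f) = eval_at (\<lambda>i. x i ^ d) f"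
  by (simp add: eval_at_substitute eval_at_hom)

lemma twist_power:
  fixes q y :: "'a::comm_monoid_mult"
  assumes "q ^ d = 1"
  shows "(q ^ k * y) ^ d = y ^ d"
  by (metis assms mult_1 power_commutes power_mult power_mult_distrib power_one mult.commute)

lemma eval_at_twist_substitute_power:
  assumes "q ^ d = 1"
  shows "eval_at (\<lambda>i. q ^ a i * x i) (substitute (\<lambda>i. Var i ^ d) f) = eval_at (\<lambda>i. x i ^ d) f"
  by (simp add: eval_at_substitute_power twist_power[OF assms])

text \<open>For b other than a, take the coordinate of the b-twisted point at an index where a and b
  differ. It is no coordinate of the a-twisted point: equal d-th powers would force the same index,
  and then equal powers of q. The product of that value minus each variable is symmetric and
  vanishes at b but not at a; p multiplies these over all b.\<close>

lemma sym_polys_separate_twists: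
  assumes q: "primitive_root_of_unity d q"
    and x: "generic_point n (\<lambda>i. x i ^ d)" and a: "a \<in> twists n d"
  obtains p where "p \<in> sym_polys n" "eval_at (\<lambda>i. q ^ a i * x i) p \<noteq> 0"
    "\<And>b. b \<in> twists n d \<Longrightarrow> b \<noteq> a \<Longrightarrow> eval_at (\<lambda>i. q ^ b i * x i) p = 0"
proof -
  have d: "d > 0" "q ^ d = 1"
    using q by (auto simp: primitive_root_of_unity_def)
  then have q0: "q \<noteq> 0"
    by (auto simp: power_0_left)
  let ?B = "twists n d - {a}"
  have "\<exists>i<n. b i \<noteq> a i" if "b \<in> ?B" for b
    using that a by (auto simp: twists_def dest: PiE_ext)
  then obtain idx where idx: "idx b < n" "b (idx b) \<noteq> a (idx b)" if "b \<in> ?B" for b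
    by metis
  define p where "p = (\<Prod>b\<in>?B. \<Prod>i<n. Const (q ^ b (idx b) * x (idx b)) - Var i)"
  have fin: "finite ?B"
    by (simp add: twists_def finite_PiE)
  have eval: "eval_at y p = (\<Prod>b\<in>?B. \<Prod>i<n. q ^ b (idx b) * x (idx b) - y i)" for y
    by (simp add: p_def eval_at_hom eval_at_diff)
  note pow = twist_power[OF d(2)]
  show thesis
  proof
    show "p \<in> sym_polys n"
      unfolding p_def by (intro sym_polys_prod sym_polys_prod_Const_minus_Var)
    have "q ^ b (idx b) * x (idx b) \<noteq> q ^ a i * x i" if b: "b \<in> ?B" and i: "i < n" for b i
    proof
      assume eq: "q ^ b (idx b) * x (idx b) = q ^ a i * x i"
      then have "x (idx b) ^ d = x i ^ d"
        by (metis pow)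
      then have "i = idx b"
        using x idx(1)[OF b] i by (auto simp: generic_point_def inj_on_def)
      moreover have "x (idx b) \<noteq> 0"
        using x idx(1)[OF b] d(1) by (auto simp: generic_point_def)
      ultimately have "q ^ b (idx b) = q ^ a (idx b)"
        using eq by simp
      moreover have "b (idx b) < d" "a (idx b) < d"
        using a b idx(1)[OF b] by (auto simp: twists_def)
      ultimately show False
        using primitive_root_power_inj[OF q] idx(2)[OF b] by blast
    qed
    then show "eval_at (\<lambda>i. q ^ a i * x i) p \<noteq> 0"
      using fin by (simp add: eval)
    fix b assume "b \<in> twists n d" "b \<noteq> a"
    then have "b \<in> ?B" by simp
    moreover from this have "(\<Prod>i<n. q ^ b (idx b) * x (idx b) - q ^ b i * x i) = 0"
      using idx(1) by (auto intro!: prod_zero)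
    ultimately show "eval_at (\<lambda>i. q ^ b i * x i) p = 0"
      using fin unfolding eval by (intro prod_zero) auto
  qed
qed

text \<open>Dilated polynomials are constant on the twists of x, so writing a separating polynomial
  through \<open>sym_polys_generated\<close> exhibits an indicator function as a constant
  combination of the restrictions of \<open>g\<close>.\<close>

lemma coefficients_vanish_on_fibre:
  assumes n: "n > 0" and q: "primitive_root_of_unity d q"
    and g: "\<And>\<mu>. \<mu> \<in> slim_partitions n d \<Longrightarrow> g \<mu> \<in> sym_polys n \<and> has_highest_partition n (g \<mu>) \<mu>"
    and x: "generic_point n (\<lambda>i. x i ^ d)"
    and zero: "\<And>a. a \<in> twists n d \<Longrightarrow> eval_at (\<lambda>i. q ^ a i * x i)
      (\<Sum>\<mu>\<in>slim_partitions n d. substitute (\<lambda>i. Var i ^ d) (h \<mu>) * g \<mu>) = 0"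
    and \<mu>: "\<mu> \<in> slim_partitions n d"
  shows "eval_at (\<lambda>i. x i ^ d) (h \<mu>) = 0"
proof (rule separating_family_injective[where c = "\<lambda>\<mu>. eval_at (\<lambda>i. x i ^ d) (h \<mu>)"
      and S = "slim_partitions n d" and A = "twists n d"
      and w = "\<lambda>\<mu> a. eval_at (\<lambda>i. q ^ a i * x i) (g \<mu>)"])
  let ?S = "slim_partitions n d"
  have d: "d > 0" "q ^ d = 1"
    using q by (auto simp: primitive_root_of_unity_def)
  have eval: "eval_at (\<lambda>i. q ^ a i * x i) (\<Sum>\<mu>\<in>?S. substitute (\<lambda>i. Var i ^ d) (h \<mu>) * g \<mu>)
      = (\<Sum>\<mu>\<in>?S. eval_at (\<lambda>i. x i ^ d) (h \<mu>) * eval_at (\<lambda>i. q ^ a i * x i) (g \<mu>))" for a h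
    by (simp add: eval_at_hom eval_at_twist_substitute_power[OF d(2)])
  show "finite ?S" by (rule finite_slim_partitions)
  show "finite (twists n d)"
    by (simp add: twists_def finite_PiE)
  show "card ?S \<le> card (twists n d)"
    using card_slim_partitions_le[of n d] by (simp add: twists_def card_PiE)
  show "\<mu> \<in> ?S" by (rule \<mu>)
  show "(\<Sum>\<mu>\<in>?S. eval_at (\<lambda>i. x i ^ d) (h \<mu>) * eval_at (\<lambda>i. q ^ b i * x i) (g \<mu>)) = 0"
    if "b \<in> twists n d" for b
    using zero[OF that] by (simp add: eval)
  fix a assume a: "a \<in> twists n d"
  obtain p where p: "p \<in> sym_polys n" "eval_at (\<lambda>i. q ^ a i * x i) p \<noteq> 0"
    "\<And>b. b \<in> twists n d \<Longrightarrow> b \<noteq> a \<Longrightarrow> eval_at (\<lambda>i. q ^ b i * x i) p = 0"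
    using sym_polys_separate_twists[OF q x a] by blast
  obtain u where u: "p = (\<Sum>\<mu>\<in>?S. substitute (\<lambda>i. Var i ^ d) (u \<mu>) * g \<mu>)"
    using sym_polys_generated[OF d(1) n g p(1)] by (auto simp: dilated_span_def)
  \<comment> \<open>Division by the value at a normalises the separating polynomial to 1 there;
    these coefficients do not depend on the twist b.\<close>
  let ?c = "\<lambda>\<mu>. eval_at (\<lambda>i. x i ^ d) (u \<mu>) / eval_at (\<lambda>i. q ^ a i * x i) p"
  have "(\<Sum>\<mu>\<in>?S. ?c \<mu> * eval_at (\<lambda>i. q ^ b i * x i) (g \<mu>)) =
      eval_at (\<lambda>i. q ^ b i * x i) p / eval_at (\<lambda>i. q ^ a i * x i) p" for b
    using eval[of b u] by (simp add: sum_divide_distrib flip: u)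
  then show "\<exists>c. \<forall>b\<in>twists n d. (\<Sum>\<mu>\<in>?S. c \<mu> * eval_at (\<lambda>i. q ^ b i * x i) (g \<mu>)) = (if b = a then 1 else 0)"
    using p by (intro exI[of _ ?c]) auto
qed

section \<open>Vanishing at generic points\<close>

text \<open>All but finitely many points of the line through y in direction z are generic, and
  evaluation is continuous at s = 0. Only points of this line are tested, so the lemma applies
  inside any linear subspace containing y and z.\<close>

lemma eval_at_eq_0_if_generic:
  assumes z: "generic_point n z"
    and zero: "\<And>s. generic_point n (\<lambda>i. y i + s * z i) \<Longrightarrow> eval_at (\<lambda>i. y i + s * z i) h = 0"
  shows "eval_at y h = 0"
proof -
  let ?P = "\<lambda>s i. y i + s * z i"
  have fin: "finite {s. u + s * v = 0}" if "v \<noteq> 0" for u v :: complex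
  proof (rule finite_subset)
    show "{s. u + s * v = 0} \<subseteq> {- u / v}"
      using that by (auto simp: field_simps eq_neg_iff_add_eq_0)
  qed simp
  \<comment> \<open>The parameters at which a coordinate vanishes or two coordinates meet. Each
    condition is affine in s with nonzero slope because z is generic.\<close>
  define B where "B = (\<Union>i<n. {s. y i + s * z i = 0}) \<union>
    (\<Union>i<n. \<Union>j\<in>{..<n} - {i}. {s. (y i - y j) + s * (z i - z j) = 0})"
  have "finite B"
    unfolding B_def using z by (intro finite_UnI finite_UN_I fin) (auto simp: generic_point_def inj_on_def)
  then have "\<forall>\<^sub>F s in at 0. \<forall>b\<in>B. s \<noteq> b"
    by (intro eventually_ball_finite ballI eventually_neq_at_within)
  then have "\<forall>\<^sub>F s in at 0. eval_at (?P s) h = 0"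
  proof eventually_elim
    case (elim s)
    then have s: "s \<notin> B" by auto
    have "generic_point n (?P s)"
      unfolding generic_point_def
    proof (intro conjI allI impI inj_onI)
      fix i assume "i < n"
      then show "?P s i \<noteq> 0"
        using s by (auto simp: B_def)
    next
      fix i j assume ij: "i \<in> {..<n}" "j \<in> {..<n}" "?P s i = ?P s j"
      show "i = j"
      proof (rule ccontr)
        assume "i \<noteq> j"
        moreover have "(y i - y j) + s * (z i - z j) = 0"
          using ij(3) by (simp add: algebra_simps)
        ultimately have "s \<in> B"
          unfolding B_def using ij by blast
        with s show False by simp
      qed
    qed
    then show ?case by (rule zero)
  qed
  then have "((\<lambda>s. eval_at (?P s) h) \<longlongrightarrow> 0) (at 0)"
    by (rule tendsto_eventually)
  moreover have "((\<lambda>s. eval_at (?P s) h) \<longlongrightarrow> eval_at (?P 0) h) (at 0)"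
    unfolding eval_at_def insertion_def by (intro tendsto_intros)
  ultimately have "eval_at (?P 0) h = 0"
    by (intro tendsto_unique[of "at (0::complex)"]) auto
  then show ?thesis by simp
qed

lemma base_representation_unique:
  fixes a b :: "nat \<Rightarrow> nat"
  assumes "\<And>i. a i < B" "\<And>i. b i < B" "(\<Sum>i<n. a i * B ^ i) = (\<Sum>i<n. b i * B ^ i)" "i < n"
  shows "a i = b i"
  using assms
proof (induction n arbitrary: a b i)
  case (Suc n)
  have shift: "(\<Sum>i<Suc n. c i * B ^ i) = c 0 + B * (\<Sum>i<n. c (Suc i) * B ^ i)" for c :: "nat \<Rightarrow> nat"
    by (simp only: sum.lessThan_Suc_shift) (simp add: sum_distrib_left ac_simps)
  have eq: "a 0 + B * (\<Sum>i<n. a (Suc i) * B ^ i) = b 0 + B * (\<Sum>i<n. b (Suc i) * B ^ i)"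
    using Suc.prems(3) by (simp only: shift)
  have "a 0 = b 0"
    using arg_cong[OF eq, of "\<lambda>x. x mod B"] Suc.prems(1,2)[of 0] by simp
  moreover have "B > 0"
    using Suc.prems(1)[of 0] by simp
  ultimately have "(\<Sum>i<n. a (Suc i) * B ^ i) = (\<Sum>i<n. b (Suc i) * B ^ i)"
    using eq by simp
  then have "a (Suc j) = b (Suc j)" if "j < n" for j
    using Suc.IH[of "\<lambda>i. a (Suc i)" "\<lambda>i. b (Suc i)" j] Suc.prems(1,2) that by simp
  then show ?case
    using \<open>a 0 = b 0\<close> Suc.prems(4) by (cases i) auto
qed simp

text \<open>Kronecker's substitution of \<open>z ^ B ^ i\<close> for the \<open>i\<close>-th variable reduces this to polynomials in one variable.\<close>

lemma poly_eq_0_if_eval_at_eq_0: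
  assumes f: "f \<in> polys n" and zero: "\<And>x. eval_at x f = 0"
  shows "f = 0"
proof (rule poly_mapping_eqI)
  fix m0
  \<comment> \<open>Larger than every exponent in f, so exponents are base-B digits and \<phi> is
    injective on the monomials of f.\<close>
  define B where "B = Suc (\<Sum>m\<in>keys f. \<Sum>i\<in>keys m. lookup m i)"
  have B: "lookup m i < B" if "m \<in> keys f" for m i
  proof (cases "i \<in> keys m")
    case True
    then have "lookup m i \<le> (\<Sum>i\<in>keys m. lookup m i)"
      by (intro member_le_sum) auto
    also have "\<dots> \<le> (\<Sum>m\<in>keys f. \<Sum>i\<in>keys m. lookup m i)"
      using that by (intro member_le_sum) auto
    finally show ?thesis
      by (simp add: B_def)
  qed (auto simp: B_def in_keys_iff)
  define \<phi> where "\<phi> m = (\<Sum>i<n. lookup m i * B ^ i)" for m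
  have inj: "m = m'" if "m \<in> keys f" "m' \<in> keys f" "\<phi> m = \<phi> m'" for m m'
  proof (rule poly_mapping_eqI)
    fix i
    show "lookup m i = lookup m' i"
    proof (cases "i < n")
      case True
      then show ?thesis
        using base_representation_unique[of "lookup m" B "lookup m'" n i] that B by (simp add: \<phi>_def)
    next
      case False
      then have "i \<notin> keys m" "i \<notin> keys m'"
        using f that by (auto simp: polys_def)
      then show ?thesis by (simp add: in_keys_iff)
    qed
  qed
  define p where "p = (\<Sum>m\<in>keys f. monom (lookup f m) (\<phi> m))"
  have "poly p z = 0" for z
  proof -
    have "mon_val (\<lambda>i. z ^ B ^ i) m = z ^ \<phi> m" if "m \<in> keys f" for m
    proof -
      have "mon_val (\<lambda>i. z ^ B ^ i) m = (\<Prod>i<n. (z ^ B ^ i) ^ lookup m i)"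
        using f that by (intro mon_val_superset) (auto simp: polys_def)
      also have "\<dots> = z ^ \<phi> m"
        by (simp add: \<phi>_def power_sum mult.commute flip: power_mult)
      finally show ?thesis .
    qed
    then have "poly p z = eval_at (\<lambda>i. z ^ B ^ i) f"
      by (simp add: p_def poly_sum poly_monom eval_at_def eval.insertion_superset[of "keys f"])
    then show ?thesis
      by (simp add: zero)
  qed
  then have "p = 0"
    using poly_all_0_iff_0 by blast
  then have "0 = coeff p (\<phi> m0)"
    by simp
  also have "\<dots> = (\<Sum>m\<in>keys f. if \<phi> m = \<phi> m0 then lookup f m else 0)"
    by (simp add: p_def coeff_sum)
  also have "\<dots> = lookup f m0" if "m0 \<in> keys f"
  proof -
    have "(\<Sum>m\<in>keys f. if \<phi> m = \<phi> m0 then lookup f m else 0) = (\<Sum>m\<in>keys f. if m = m0 then lookup f m else 0)"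
      using inj that by (intro sum.cong) auto
    then show ?thesis
      using that by simp
  qed
  finally show "lookup f m0 = lookup 0 m0"
    by (cases "m0 \<in> keys f") (auto simp: in_keys_iff)
qed

section \<open>The spaces of symmetric polynomials with a vanishing condition\<close>

lemma F_space_iff:
  assumes "r \<ge> 2"
  shows "f \<in> F_space n k r t q \<longleftrightarrow> f \<in> sym_polys n \<and>
    (k < n \<longrightarrow> (\<forall>s x. (\<forall>i\<in>{1..k}. s i < r - 1 \<and> x i = t ^ i * q ^ s i * x 0) \<longrightarrow> eval_at x f = 0))"
proof -
  have "s i \<in> {0..r - 2} \<longleftrightarrow> s i < r - 1" for s :: "nat \<Rightarrow> nat" and i
    using assms by auto
  then show ?thesis
    unfolding F_space_def by (auto simp: ball_conj_distrib)
qed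

lemma subspace_F_space: "cpoly.subspace (F_space n k r t q)"
  using cpoly.subspace_0[OF subspace_sym_polys] cpoly.subspace_add[OF subspace_sym_polys]
    cpoly.subspace_scale[OF subspace_sym_polys]
  unfolding cpoly.subspace_def F_space_def by (auto simp: eval_at_hom)

lemma coprime_mult_mod_permutes:
  fixes e m :: nat
  assumes "coprime e m"
  shows "(\<lambda>i. if i < m then (e * i) mod m else i) permutes {..<m}"
proof (rule bij_imp_permutes)
  let ?p = "\<lambda>i. if i < m then (e * i) mod m else i"
  have "inj_on ?p {..<m}"
  proof (rule inj_onI)
    fix i j assume "i \<in> {..<m}" "j \<in> {..<m}" "?p i = ?p j"
    then have "[e * i = e * j] (mod m)" "i < m" "j < m"
      by (auto simp: cong_def)
    then have "[i = j] (mod m)"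
      using cong_mult_lcancel_nat[of e m i j] assms by simp
    then show "i = j"
      using \<open>i < m\<close> \<open>j < m\<close> by (simp add: cong_less_modulus_unique_nat)
  qed
  moreover from this have "?p ` {..<m} = {..<m}"
    by (rule endo_inj_surj[OF finite_lessThan, rotated]) auto
  ultimately show "bij_betw ?p {..<m} {..<m}"
    unfolding bij_betw_def by (rule conjI)
qed auto

text \<open>Replacing \<open>t\<close> by another primitive root of the same order only permutes the coordinates.\<close>

lemma F_space_root_power:
  assumes t: "primitive_root_of_unity (k + 1) t" and e: "coprime e (k + 1)" and r: "r \<ge> 2"
    and f: "f \<in> F_space n k r t q"
  shows "f \<in> F_space n k r (t ^ e) q"
  unfolding F_space_iff[OF r]
proof (intro conjI allI impI)
  show sym: "f \<in> sym_polys n"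
    using f by (simp add: F_space_iff[OF r])
  fix s x assume k: "k < n"
    and x: "\<forall>i\<in>{1..k}. s i < r - 1 \<and> x i = (t ^ e) ^ i * q ^ s i * x 0"
  obtain e' where e': "[e * e' = 1] (mod (k + 1))"
    using cong_solve_coprime_nat[OF e] by auto
  have "coprime e' (k + 1)"
    using e' by (metis coprime_iff_invertible_nat mult.commute One_nat_def)
  \<comment> \<open>Multiplication by the inverse of e modulo k + 1: it fixes 0 and turns
    (t^e)^(\<sigma> i) back into t^i. The exponents s are permuted along with the
    coordinates.\<close>
  define \<sigma> where "\<sigma> i = (if i < k + 1 then (e' * i) mod (k + 1) else i)" for i
  have "\<sigma> permutes {..<k + 1}"
    unfolding \<sigma>_def by (rule coprime_mult_mod_permutes) fact
  then have \<sigma>: "\<sigma> permutes {..<k + 1}" "\<sigma> permutes {..<n}"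
    using k by (auto intro: permutes_subset)
  have \<sigma>0: "\<sigma> 0 = 0"
    by (simp add: \<sigma>_def)
  have "s (\<sigma> i) < r - 1 \<and> x (\<sigma> i) = t ^ i * q ^ s (\<sigma> i) * x (\<sigma> 0)" if i: "i \<in> {1..k}" for i
  proof -
    have "\<sigma> i \<noteq> 0"
      using permutes_inj[OF \<sigma>(1)] \<sigma>0 i by (metis atLeastAtMost_iff injD not_one_le_zero)
    moreover have "\<sigma> i < k + 1"
      using i by (simp add: \<sigma>_def)
    ultimately have \<sigma>i: "\<sigma> i \<in> {1..k}"
      by simp
    have "[e * \<sigma> i = e * (e' * i)] (mod (k + 1))"
      using i by (auto simp: \<sigma>_def cong_def mod_mult_right_eq)
    also have "[e * (e' * i) = i] (mod (k + 1))"
      using cong_scalar_right[OF e', of i] by (simp add: mult.assoc)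
    finally have "t ^ (e * \<sigma> i) = t ^ i"
      using primitive_root_power_mod[OF t, of "e * \<sigma> i"] primitive_root_power_mod[OF t, of i]
      by (simp add: cong_def)
    then show ?thesis
      using x \<sigma>i \<sigma>0 by (simp add: power_mult)
  qed
  then have "eval_at (\<lambda>i. x (\<sigma> i)) f = 0"
    using f k unfolding F_space_iff[OF r]
    by (elim conjE impE allE[of _ "\<lambda>i. s (\<sigma> i)"] allE[of _ "\<lambda>i. x (\<sigma> i)"]) auto
  then show "eval_at x f = 0"
    using eval_at_sym_permute[OF sym \<sigma>(2)] by simp
qed

text \<open>Supplies the direction for \<open>eval_at_eq_0_if_generic\<close>. The first k + 1
  coordinates satisfy the root condition and lie on the unit circle; the others are distinct
  integers greater than 1, so they cannot collide with these.\<close>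

lemma generic_root_point:
  assumes "primitive_root_of_unity (k + 1) t"
  shows "generic_point n (\<lambda>i. if i \<le> k then t ^ i else of_nat (i + 1))" (is "generic_point n ?z")
proof -
  have "t ^ (k + 1) = 1"
    using assms by (simp add: primitive_root_of_unity_def)
  then have norm: "norm t = 1"
    using power_eq_1_iff by force
  have "?z i \<noteq> 0" for i
    using norm by (auto simp: simp del: of_nat_Suc of_nat_add)
  moreover have "i = j" if "?z i = ?z j" for i j
  proof -
    have "norm (?z i) = norm (?z j)"
      using that by simp
    then have "i \<le> k \<longleftrightarrow> j \<le> k" "i > k \<Longrightarrow> j > k \<Longrightarrow> i = j"
      using norm by (auto simp: norm_power simp del: of_nat_Suc of_nat_add split: if_splits)
    moreover have "i = j" if "i \<le> k" "j \<le> k"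
      using primitive_root_power_inj[OF assms, of i j] that \<open>?z i = ?z j\<close> by simp
    ultimately show ?thesis by linarith
  qed
  ultimately show ?thesis
    by (auto simp: generic_point_def inj_on_def)
qed

lemma primitive_root_of_unity_power:
  assumes "primitive_root_of_unity m t" "coprime e m"
  shows "primitive_root_of_unity m (t ^ e)"
  unfolding primitive_root_of_unity_def
proof (intro conjI allI impI notI)
  show "m > 0"
    using assms(1) by (simp add: primitive_root_of_unity_def)
  have "(t ^ e) ^ m = (t ^ m) ^ e"
    by (simp add: mult.commute flip: power_mult)
  then show "(t ^ e) ^ m = 1"
    using assms(1) by (simp add: primitive_root_of_unity_def)
  fix j assume j: "0 < j \<and> j < m" "(t ^ e) ^ j = 1"
  then have "t ^ ((e * j) mod m) = t ^ 0"
    by (simp add: primitive_root_power_mod[OF assms(1)] power_mult)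
  then have "(e * j) mod m = 0"
    using j by (intro primitive_root_power_inj[OF assms(1)]) auto
  then have "m dvd e * j"
    by (simp add: dvd_eq_mod_eq_0)
  then have "m dvd j"
    using assms(2) by (simp add: coprime_commute coprime_dvd_mult_right_iff)
  then show False
    using j by (auto dest: dvd_imp_le)
qed

text \<open>Taking d-th powers (d = r - 1) of the coordinates kills the powers of q and replaces t
  by t^d, so h is first moved to the condition for t^d.\<close>

lemma substitute_power_mult_in_F_space:
  assumes r: "r \<ge> 2" and co: "coprime (k + 1) (r - 1)"
    and t: "primitive_root_of_unity (k + 1) t" and q: "q ^ (r - 1) = 1"
    and h: "h \<in> F2_space n k t" and g: "g \<in> sym_polys n"
  shows "substitute (\<lambda>i. Var i ^ (r - 1)) h * g \<in> F_space n k r t q"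
  unfolding F_space_iff[OF r]
proof (intro conjI allI impI)
  have h': "h \<in> F2_space n k (t ^ (r - 1))"
    using co by (intro F_space_root_power t h) (auto simp: coprime_commute)
  show "substitute (\<lambda>i. Var i ^ (r - 1)) h * g \<in> sym_polys n"
    using h g by (intro sym_polys_mult sym_polys_substitute_power) (auto simp: mem_F2_space_iff)
  fix s x assume k: "k < n" and x: "\<forall>i\<in>{1..k}. s i < r - 1 \<and> x i = t ^ i * q ^ s i * x 0"
  have "x i ^ (r - 1) = (t ^ (r - 1)) ^ i * x 0 ^ (r - 1)" if "i \<in> {1..k}" for i
  proof -
    have "(q ^ s i) ^ (r - 1) = (q ^ (r - 1)) ^ s i" "(t ^ i) ^ (r - 1) = (t ^ (r - 1)) ^ i"
      by (simp_all add: mult.commute flip: power_mult)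
    then show ?thesis
      using x that by (simp add: power_mult_distrib q del: One_nat_def)
  qed
  then have "eval_at (\<lambda>i. x i ^ (r - 1)) h = 0"
    using h' k by (simp add: mem_F2_space_iff)
  then show "eval_at x (substitute (\<lambda>i. Var i ^ (r - 1)) h * g) = 0"
    by (simp add: eval_at_hom eval_at_substitute_power)
qed

text \<open>Leaves the choice of the d-th roots x of y open: \<open>coefficients_in_F2_space\<close>
  needs roots adapted to the vanishing condition, \<open>coefficients_eq_0\<close> takes arbitrary
  ones.\<close>

lemma coefficients_vanish_at_generic_power:
  assumes n: "n > 0" and q: "primitive_root_of_unity d q"
    and g: "\<And>\<mu>. \<mu> \<in> slim_partitions n d \<Longrightarrow> g \<mu> \<in> sym_polys n \<and> has_highest_partition n (g \<mu>) \<mu>"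
    and h: "h \<mu> \<in> sym_polys n" and \<mu>: "\<mu> \<in> slim_partitions n d"
    and y: "generic_point n y" and xy: "\<And>i. i < n \<Longrightarrow> x i ^ d = y i"
    and zero: "\<And>a. a \<in> twists n d \<Longrightarrow> eval_at (\<lambda>i. q ^ a i * x i)
      (\<Sum>\<mu>\<in>slim_partitions n d. substitute (\<lambda>i. Var i ^ d) (h \<mu>) * g \<mu>) = 0"
  shows "eval_at y (h \<mu>) = 0"
proof -
  have "generic_point n (\<lambda>i. x i ^ d)"
    using y xy by (auto simp: generic_point_def inj_on_def)
  then have "eval_at (\<lambda>i. x i ^ d) (h \<mu>) = 0"
    using zero by (intro coefficients_vanish_on_fibre[where h = h, OF n q g _ _ \<mu>])
  then show ?thesis
    using eval_at_cong[of "h \<mu>" n y "\<lambda>i. x i ^ d"] xy h by (simp add: sym_polys_def)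
qed

lemma ex_complex_root:
  assumes "d > 0"
  shows "\<exists>w. w ^ d = (z :: complex)"
proof -
  have "rcis (root d (cmod z)) (Arg z / real d) ^ d = z"
    using assms by (simp add: DeMoivre2 rcis_cmod_Arg)
  then show ?thesis by blast
qed

lemma coefficients_in_F2_space:
  assumes r: "r \<ge> 2" and n: "n > 0" and co: "coprime (k + 1) (r - 1)"
    and t: "primitive_root_of_unity (k + 1) t" and q: "primitive_root_of_unity (r - 1) q"
    and g: "\<And>\<mu>. \<mu> \<in> slim_partitions n (r - 1) \<Longrightarrow> g \<mu> \<in> sym_polys n \<and> has_highest_partition n (g \<mu>) \<mu>"
    and h: "\<And>\<mu>. \<mu> \<in> slim_partitions n (r - 1) \<Longrightarrow> h \<mu> \<in> sym_polys n"
    and F: "(\<Sum>\<mu>\<in>slim_partitions n (r - 1). substitute (\<lambda>i. Var i ^ (r - 1)) (h \<mu>) * g \<mu>)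
      \<in> F_space n k r t q" (is "?f \<in> _")
    and \<mu>: "\<mu> \<in> slim_partitions n (r - 1)"
  shows "h \<mu> \<in> F2_space n k t"
proof -
  let ?d = "r - 1" and ?t = "t ^ (r - 1)"
  have d: "?d > 0" "q ^ ?d = 1"
    using q by (auto simp: primitive_root_of_unity_def)
  have t': "primitive_root_of_unity (k + 1) ?t"
    using t co by (intro primitive_root_of_unity_power) (auto simp: coprime_commute)
  have generic: "eval_at y (h \<mu>) = 0"
    if k: "k < n" and y: "\<forall>i\<in>{1..k}. y i = ?t ^ i * y 0" "generic_point n y" for y
  proof -
    have "\<forall>i. \<exists>w. w ^ ?d = y i"
      using ex_complex_root[OF d(1)] by blast
    then obtain w where w: "w i ^ ?d = y i" for i
      by metis
    \<comment> \<open>The roots of the first k + 1 coordinates are chosen coherently from one root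
      \<open>w 0\<close>, so that x itself satisfies the relation with t.\<close>
    define x where "x i = (if i \<le> k then t ^ i * w 0 else w i)" for i
    have "x i ^ ?d = y i" for i
    proof (cases "i \<in> {1..k}")
      case True
      have "(t ^ i) ^ ?d = ?t ^ i"
        by (simp add: mult.commute flip: power_mult)
      then show ?thesis
        using True y(1) w by (simp add: x_def power_mult_distrib)
    next
      case False
      then show ?thesis
        using w by (cases "i = 0") (auto simp: x_def)
    qed
    moreover have "eval_at (\<lambda>i. q ^ a i * x i) ?f = 0" if a: "a \<in> twists n ?d" for a
    proof -
      let ?s = "\<lambda>i. (a i + (?d - a 0)) mod ?d"
      have "?s i < ?d \<and> q ^ a i * x i = t ^ i * q ^ ?s i * (q ^ a 0 * x 0)" if i: "i \<in> {1..k}" for i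
      proof -
        have a0: "a 0 < ?d"
          using a n by (auto simp: twists_def)
        have "q ^ ?s i * q ^ a 0 = q ^ (a i + (?d - a 0) + a 0)"
          by (simp only: primitive_root_power_mod[OF q] power_add)
        also have "a i + (?d - a 0) + a 0 = a i + ?d"
          using a0 by simp
        also have "q ^ (a i + ?d) = q ^ a i"
          using d(2) by (simp only: power_add mult_1_right)
        finally show ?thesis
          using i d(1) by (simp add: x_def mult_ac)
      qed
      then show ?thesis
        using F k unfolding F_space_iff[OF r]
        by (elim conjE impE allE[of _ ?s] allE[of _ "\<lambda>i. q ^ a i * x i"]) auto
    qed
    ultimately show ?thesis
      using coefficients_vanish_at_generic_power[where h = h, OF n q g h[OF \<mu>] \<mu> y(2), of x] by blast
  qed
  have "h \<mu> \<in> F2_space n k ?t"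
    unfolding mem_F2_space_iff
  proof (intro conjI allI impI)
    show "h \<mu> \<in> sym_polys n"
      using h \<mu> by blast
    fix y assume k: "k < n" and y: "\<forall>i\<in>{1..k}. y i = ?t ^ i * y 0"
    show "eval_at y (h \<mu>) = 0"
    proof (rule eval_at_eq_0_if_generic[OF generic_root_point[OF t']])
      fix s
      \<comment> \<open>The condition is linear and the direction satisfies it too, so the whole
        line stays inside it.\<close>
      let ?y = "\<lambda>i. y i + s * (if i \<le> k then ?t ^ i else of_nat (i + 1))"
      assume "generic_point n ?y"
      then show "eval_at ?y (h \<mu>) = 0"
        using y by (intro generic k) (auto simp: algebra_simps)
    qed
  qed
  \<comment> \<open>So far the condition is known for t^d; raising to the inverse of d modulo k + 1
    returns to t.\<close>
  moreover obtain e where e: "[?d * e = 1] (mod (k + 1))"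
    using cong_solve_coprime_nat[of ?d "k + 1"] co by (auto simp: coprime_commute)
  moreover have "coprime e (k + 1)"
    using e by (metis coprime_iff_invertible_nat mult.commute One_nat_def)
  ultimately have "h \<mu> \<in> F2_space n k (?t ^ e)"
    using F_space_root_power[OF t'] by simp
  also have "?t ^ e = t"
    using primitive_root_power_mod[OF t, of "?d * e"] primitive_root_power_mod[OF t, of 1] e
    by (simp add: cong_def power_mult)
  finally show ?thesis .
qed

text \<open>Freeness of the module: the zero polynomial vanishes on every fibre, so h vanishes at
  all generic points, hence everywhere. The generic direction is (1, 2, ..., n).\<close>

lemma coefficients_eq_0:
  assumes n: "n > 0" and q: "primitive_root_of_unity d q"
    and g: "\<And>\<mu>. \<mu> \<in> slim_partitions n d \<Longrightarrow> g \<mu> \<in> sym_polys n \<and> has_highest_partition n (g \<mu>) \<mu>"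
    and h: "\<And>\<mu>. \<mu> \<in> slim_partitions n d \<Longrightarrow> h \<mu> \<in> sym_polys n"
    and zero: "(\<Sum>\<mu>\<in>slim_partitions n d. substitute (\<lambda>i. Var i ^ d) (h \<mu>) * g \<mu>) = 0"
    and \<mu>: "\<mu> \<in> slim_partitions n d"
  shows "h \<mu> = 0"
proof (rule poly_eq_0_if_eval_at_eq_0[of _ n])
  show "h \<mu> \<in> polys n"
    using h[OF \<mu>] by (simp add: sym_polys_def)
  have d: "d > 0"
    using q by (simp add: primitive_root_of_unity_def)
  have generic: "eval_at y (h \<mu>) = 0" if y: "generic_point n y" for y
  proof -
    have "\<forall>i. \<exists>w. w ^ d = y i"
      using ex_complex_root[OF d] by blast
    then obtain w where "w i ^ d = y i" for i
      by metis
    then show ?thesis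
      by (intro coefficients_vanish_at_generic_power[where h = h and x = w, OF n q g h[OF \<mu>] \<mu> y])
         (auto simp: zero eval_at_hom)
  qed
  have "generic_point n (\<lambda>i. of_nat (i + 1))"
    by (auto simp: generic_point_def inj_on_def simp del: of_nat_Suc of_nat_add)
  then show "eval_at y (h \<mu>) = 0" for y
    by (rule eval_at_eq_0_if_generic) (rule generic)
qed

text \<open>A criterion in terms of indices. Relations over two indices with coefficients 1 and -1
  rule out repetitions, so injectivity need not be shown apart from independence.\<close>

lemma is_basisI:
  assumes zero: "\<And>J c j. finite J \<Longrightarrow> J \<subseteq> I \<Longrightarrow> (\<Sum>j\<in>J. scale (c j) (b j)) = 0 \<Longrightarrow> j \<in> J \<Longrightarrow> c j = 0"
    and "cpoly.span (b ` I) = V"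
  shows "is_basis V I b"
  unfolding is_basis_def
proof (intro conjI)
  show inj: "inj_on b I"
  proof (rule inj_onI, rule ccontr)
    fix i j assume "i \<in> I" "j \<in> I" "b i = b j" "i \<noteq> j"
    then show False
      using zero[of "{i, j}" "\<lambda>x. if x = i then 1 else - 1" i] by simp
  qed
  show "cpoly.independent (b ` I)"
    unfolding cpoly.independent_explicit_finite_subsets
  proof (intro allI impI ballI)
    fix T u v assume T: "T \<subseteq> b ` I" "finite T" "(\<Sum>v\<in>T. scale (u v) v) = 0" "v \<in> T"
    obtain J where J: "J \<subseteq> I" "finite J" "T = b ` J"
      using finite_subset_image[OF T(2,1)] by blast
    then have "(\<Sum>j\<in>J. scale (u (b j)) (b j)) = 0"
      using T(3) inj by (simp add: sum.reindex inj_on_subset)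
    then show "u v = 0"
      using zero[of J "\<lambda>j. u (b j)"] J T(4) by auto
  qed
qed fact

lemma is_basisD:
  assumes "is_basis V I b" "finite J" "J \<subseteq> I" "(\<Sum>j\<in>J. scale (c j) (b j)) = 0" "j \<in> J"
  shows "c j = 0"
proof -
  have inj: "inj_on b J"
    using assms by (auto simp: is_basis_def intro: inj_on_subset)
  have "(\<Sum>v\<in>b ` J. scale (c (the_inv_into J b v)) v) = 0"
    using assms(4) by (simp add: sum.reindex[OF inj] the_inv_into_f_f[OF inj])
  then have "c (the_inv_into J b (b j)) = 0"
    using assms by (intro cpoly.independentD[of "b ` I" "b ` J"]) (auto simp: is_basis_def)
  then show ?thesis
    using inj assms(5) by (simp add: the_inv_into_f_f)
qed

theorem theorem4p6:
  fixes k r n :: nat and t q :: complex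
    and g f' :: "nat list \<Rightarrow> cpoly"
  assumes "k \<ge> 1" and "r \<ge> 2" and "n \<ge> 1"
    and "coprime (k + 1) (r - 1)"
    and "primitive_root_of_unity (k + 1) t"
    and "primitive_root_of_unity (r - 1) q"
    and "\<And>\<mu>. \<mu> \<in> slim_partitions n (r - 1) \<Longrightarrow>
           g \<mu> \<in> sym_polys n \<and> has_highest_partition n (g \<mu>) \<mu>"
    and "is_basis (F2_space n k t) (admissible_partitions n k) f'"
  shows "is_basis (F_space n k r t q)
           (admissible_partitions n k \<times> slim_partitions n (r - 1))
           (\<lambda>(\<nu>, \<mu>). substitute (\<lambda>i. Var i ^ (r - 1)) (f' \<nu>) * g \<mu>)"
proof -
  let ?A = "admissible_partitions n k" and ?S = "slim_partitions n (r - 1)"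
  let ?P = "substitute (\<lambda>i. Var i ^ (r - 1))"
  let ?b = "\<lambda>(\<nu>, \<mu>). ?P (f' \<nu>) * g \<mu>"
  have n: "n > 0"
    using assms(3) by simp
  have q: "q ^ (r - 1) = 1"
    using assms(6) by (simp add: primitive_root_of_unity_def)
  note g = assms(7)
  have span: "cpoly.span (f' ` ?A) = F2_space n k t"
    using assms(8) by (simp add: is_basis_def)
  have f': "f' \<nu> \<in> F2_space n k t" if "\<nu> \<in> ?A" for \<nu>
    using that cpoly.span_base[of "f' \<nu>" "f' ` ?A"] by (simp add: span)
  have F2_sym: "h \<in> sym_polys n" if "h \<in> F2_space n k t" for h
    using that by (simp add: mem_F2_space_iff)
  have P_scale: "?P (scale c h) * u = scale c (?P h * u)" for c h u
    by (simp add: scale_def substitute_hom mult.assoc)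
  show ?thesis
  proof (rule is_basisI)
    fix J c j assume J: "finite J" "J \<subseteq> ?A \<times> ?S" "(\<Sum>j\<in>J. scale (c j) (?b j)) = 0" "j \<in> J"
    define N where "N = fst ` J"
    \<comment> \<open>Extension by zero from J to the rectangle \<open>N \<times> ?S\<close>, so
      that the double sum can be regrouped by \<mu>.\<close>
    define c' where "c' x = (if x \<in> J then c x else 0)" for x
    define h where "h \<mu> = (\<Sum>\<nu>\<in>N. scale (c' (\<nu>, \<mu>)) (f' \<nu>))" for \<mu>
    have N: "finite N" "N \<subseteq> ?A"
      using J by (auto simp: N_def)
    have "0 = (\<Sum>x\<in>J. scale (c' x) (?b x))"
      using J(3) by (simp add: c'_def)
    also have "\<dots> = (\<Sum>x\<in>N \<times> ?S. scale (c' x) (?b x))"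
      using J N(1) finite_slim_partitions by (intro sum.mono_neutral_left) (force simp: N_def c'_def)+
    also have "\<dots> = (\<Sum>\<mu>\<in>?S. \<Sum>\<nu>\<in>N. scale (c' (\<nu>, \<mu>)) (?P (f' \<nu>) * g \<mu>))"
      by (subst sum.swap) (simp add: sum.cartesian_product case_prod_unfold)
    also have "\<dots> = (\<Sum>\<mu>\<in>?S. ?P (h \<mu>) * g \<mu>)"
      by (simp add: h_def substitute_hom(2) sum_distrib_right P_scale del: One_nat_def)
    finally have sum0: "(\<Sum>\<mu>\<in>?S. ?P (h \<mu>) * g \<mu>) = 0" ..
    have "h \<mu> \<in> sym_polys n" for \<mu>
      unfolding h_def using N(2) f' F2_sym
      by (intro cpoly.subspace_sum[OF subspace_sym_polys] cpoly.subspace_scale[OF subspace_sym_polys]) auto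
    \<comment> \<open>Freeness removes each coefficient polynomial; independence of
      \<open>f'\<close> then removes the scalars inside it.\<close>
    then have "h \<mu> = 0" if "\<mu> \<in> ?S" for \<mu>
      using coefficients_eq_0[OF n assms(6) g _ sum0 that] by blast
    moreover obtain \<nu> \<mu> where j: "j = (\<nu>, \<mu>)" "\<nu> \<in> N" "\<mu> \<in> ?S"
      using J by (force simp: N_def)
    ultimately have "c' (\<nu>, \<mu>) = 0"
      using is_basisD[OF assms(8) N, of "\<lambda>\<nu>. c' (\<nu>, \<mu>)" \<nu>] by (simp add: h_def)
    then show "c j = 0"
      using J(4) j(1) by (simp add: c'_def)
  next
    show "cpoly.span (?b ` (?A \<times> ?S)) = F_space n k r t q"
    proof
      show "cpoly.span (?b ` (?A \<times> ?S)) \<subseteq> F_space n k r t q"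
        using substitute_power_mult_in_F_space[OF assms(2,4,5) q f'] g
        by (intro cpoly.span_minimal subspace_F_space) auto
      \<comment> \<open>For fixed \<mu> the product is linear in h, so it suffices to treat the
        basis elements \<open>f' \<nu>\<close>.\<close>
      have "?P h * g \<mu> \<in> cpoly.span (?b ` (?A \<times> ?S))" if h: "h \<in> F2_space n k t" and \<mu>: "\<mu> \<in> ?S" for h \<mu>
      proof -
        have "h \<in> cpoly.span (f' ` ?A)"
          using h span by simp
        then show ?thesis
        proof (induction rule: cpoly.span_induct_alt)
          case base
          then show ?case by (simp add: substitute_hom cpoly.span_zero)
        next
          case (step c u v)
          obtain \<nu> where \<nu>: "\<nu> \<in> ?A" "u = f' \<nu>"
            using step by blast
          have "?b (\<nu>, \<mu>) \<in> cpoly.span (?b ` (?A \<times> ?S))"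
            using \<nu>(1) \<mu> by (intro cpoly.span_base imageI) simp
          then have "scale c (?P u * g \<mu>) + ?P v * g \<mu> \<in> cpoly.span (?b ` (?A \<times> ?S))"
            using step \<nu>(2) by (intro cpoly.span_add cpoly.span_scale) auto
          then show ?case
            by (simp add: substitute_hom(1) distrib_right P_scale del: One_nat_def)
        qed
      qed
      note in_span = this
      show "F_space n k r t q \<subseteq> cpoly.span (?b ` (?A \<times> ?S))"
      proof
        fix f assume f: "f \<in> F_space n k r t q"
        then have "f \<in> sym_polys n"
          by (simp add: F_space_def)
        moreover have "r - 1 > 0"
          using assms(2) by simp
        ultimately obtain h where h: "f = (\<Sum>\<mu>\<in>?S. ?P (h \<mu>) * g \<mu>)" "\<And>\<mu>. \<mu> \<in> ?S \<Longrightarrow> h \<mu> \<in> sym_polys n"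
          using sym_polys_generated[where f = f and d = "r - 1", OF _ n g]
          unfolding dilated_span_def by blast
        have "h \<mu> \<in> F2_space n k t" if "\<mu> \<in> ?S" for \<mu>
          using coefficients_in_F2_space[where g = g and h = h, OF assms(2) n assms(4-6) g h(2) _ that] f h(1)
          by blast
        then show "f \<in> cpoly.span (?b ` (?A \<times> ?S))"
          unfolding h(1) by (intro cpoly.span_sum in_span)
      qed
    qed
  qed
qed

end
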